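(* Let $T$ be the max-plus quasi-field of reals, and let $P,Q\in T\{X_1,\dots,X_n\}$. Then $V(P)\subset V(Q)$ if and only if $P$ divides some power $Q^k$ ($k\ge1$) in $T\{X_1,\dots,X_n\}$.
   Context: $T$ is $\mathbb R_{\ge0}$ with addition $u+v=\max(u,v)$ and usual multiplication (isomorphic to $\mathbb R\cup\{-\infty\}$ with $\max$ and $+$); it is a totally ordered quasi-field of characteristic $1$. $T\{X_1,\dots,X_n\}$ is the image of $T[X_1,\dots,X_n]$ in its quasi-field of fractions, i.e. the quotient by $P\sim Q$ iff $RP=RQ$ for some nonzero $R$ (rational polynomials). A point $x\in T^n$ is a zero of a polynomial $P$ if $P(x)=0$ or the maximum of the values at $x$ of the monomials of $P$ is attained by at least two distinct monomials; this does not depend on the representative, so it defines zeros of rational polynomials. $V(P)\subset T^n$ is the set of zeros of $P$. $P$ divides $S$ means $S=PR$ for some $R\in T\{X_1,\dots,X_n\}$. *)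

theory Defs
  imports Main "HOL.Real"
begin

text \<open>Tropical (max-times) polynomials in the variables indexed by a finite type 'n,
  with coefficients in T = nonnegative reals. A polynomial is its coefficient function
  on exponent vectors; a tropical polynomial has nonnegative coefficients and finite support.\<close>

type_synonym 'n tpoly = "('n \<Rightarrow> nat) \<Rightarrow> real"

definition is_tpoly :: "'n tpoly \<Rightarrow> bool" where
  "is_tpoly P \<longleftrightarrow> (\<forall>m. P m \<ge> 0) \<and> finite {m. P m \<noteq> 0}"

definition tpoly_zero :: "'n tpoly" where
  "tpoly_zero = (\<lambda>m. 0)"

definition tpoly_one :: "'n tpoly" where
  "tpoly_one = (\<lambda>m. if m = (\<lambda>i. 0) then 1 else 0)"

definition tpoly_mult :: "'n tpoly \<Rightarrow> 'n tpoly \<Rightarrow> 'n tpoly" where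
  "tpoly_mult P Q = (\<lambda>m. Max (insert 0 {P a * Q b | a b. (\<forall>i. a i + b i = m i)}))"

fun tpoly_pow :: "'n tpoly \<Rightarrow> nat \<Rightarrow> 'n tpoly" where
  "tpoly_pow P 0 = tpoly_one"
| "tpoly_pow P (Suc k) = tpoly_mult P (tpoly_pow P k)"

text \<open>Equality in T{X}: P ~ Q iff R P = R Q for some nonzero polynomial R.\<close>
definition tpoly_equiv :: "'n tpoly \<Rightarrow> 'n tpoly \<Rightarrow> bool" where
  "tpoly_equiv P Q \<longleftrightarrow> (\<exists>R. is_tpoly R \<and> R \<noteq> tpoly_zero \<and> tpoly_mult R P = tpoly_mult R Q)"

definition tpoly_dvd :: "'n tpoly \<Rightarrow> 'n tpoly \<Rightarrow> bool" where
  "tpoly_dvd P S \<longleftrightarrow> (\<exists>R. is_tpoly R \<and> tpoly_equiv S (tpoly_mult P R))"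

definition mono_val :: "('n::finite \<Rightarrow> real) \<Rightarrow> ('n \<Rightarrow> nat) \<Rightarrow> real" where
  "mono_val x m = (\<Prod>i\<in>UNIV. x i ^ m i)"

definition is_tzero :: "'n::finite tpoly \<Rightarrow> ('n \<Rightarrow> real) \<Rightarrow> bool" where
  "is_tzero P x \<longleftrightarrow>
     (\<forall>m. P m * mono_val x m = 0) \<or>
     (\<exists>a b. a \<noteq> b \<and> P a \<noteq> 0 \<and> P b \<noteq> 0 \<and> P a * mono_val x a = P b * mono_val x b \<and>
            (\<forall>c. P c * mono_val x c \<le> P a * mono_val x a))"

definition tvar :: "'n::finite tpoly \<Rightarrow> ('n \<Rightarrow> real) set" where
  "tvar P = {x. (\<forall>i. 0 \<le> x i) \<and> is_tzero P x}"

end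

theory Submission
  imports Defs Complex_Main
begin

text \<open>In logarithmic coordinates a polynomial is a maximum of finitely many affine functions, and two polynomials
  are equal in the quotient iff they define the same function: if a monomial \<open>M\<close> lies below \<open>A\<close> everywhere, then
  an integral Farkas lemma (Fourier--Motzkin elimination) yields \<open>M\<^sup>N \<le> A\<^sup>N\<close> coefficientwise, so that
  \<open>(A + M)\<^sup>N = A (A + M)\<^bsup>N - 1\<^esup>\<close>.

  Suppose \<open>V(P) \<subseteq> V(Q)\<close>. On the cell where a monomial \<open>b\<close> strictly dominates \<open>Q\<close>, a single monomial \<open>\<alpha>(b)\<close>
  dominates \<open>P\<close>. For large \<open>k\<close> the quotient \<open>R = max b\<^sup>k / \<alpha>(b)\<close> is a polynomial with \<open>P R = Q\<^sup>k\<close>: between any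
  two cells the change of slope of \<open>P\<close> is bounded by a multiple of that of \<open>Q\<close> (Farkas again), and the
  exponents of \<open>R\<close> are nonnegative because the inclusion also holds at points with a zero coordinate.
  Conversely, a point with a single dominating monomial of \<open>Q\<^sup>k = P R\<close> has a single one of \<open>P\<close>.\<close>

section \<open>Fourier--Motzkin elimination\<close>

text \<open>Picks the value of an eliminated coordinate between its finitely many lower bounds
  \<open>L\<close> and upper bounds \<open>U\<close>; either set may be empty.\<close>

lemma finite_sandwich:
  fixes L U :: "real set"
  assumes "finite L" "finite U" "\<And>l u. l \<in> L \<Longrightarrow> u \<in> U \<Longrightarrow> l \<le> u"
  shows "\<exists>t. (\<forall>l\<in>L. l \<le> t) \<and> (\<forall>u\<in>U. t \<le> u)"
proof (cases "L = {}")
  case True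
  then show ?thesis using assms(2) by (intro exI[of _ "Min (insert 0 U)"]) auto
next
  case False
  then show ?thesis using assms by (intro exI[of _ "Max L"]) auto
qed

text \<open>The finite set \<open>\<N>\<close> of multipliers depends only on the linear parts \<open>v\<close> and serves all constants \<open>c\<close> at
  once. This uniformity allows letting \<open>c\<close> vary in the two Farkas lemmas below.\<close>

lemma fourier_motzkin_aux:
  fixes v :: "'j \<Rightarrow> 'i \<Rightarrow> int"
  assumes "finite J" "finite I"
  shows "\<exists>\<N>. finite \<N> \<and>
     (\<forall>N\<in>\<N>. (\<exists>j\<in>J. N j > (0::nat)) \<and> (\<forall>i\<in>I. (\<Sum>j\<in>J. int (N j) * v j i) = 0)) \<and>
     (\<forall>c. (\<forall>N\<in>\<N>. 0 \<le> (\<Sum>j\<in>J. real (N j) * c j)) \<longrightarrow>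
        (\<exists>y. \<forall>j\<in>J. 0 \<le> (\<Sum>i\<in>I. real_of_int (v j i) * y i) + c j))"
  using assms(2)
proof (induction I rule: finite_induct)
  case empty
  have *: "(\<Sum>j'\<in>J. real (if j' = j then 1 else 0) * c j') = c j" if "j \<in> J" for j and c :: "'j \<Rightarrow> real"
  proof -
    have "(\<Sum>j'\<in>J. real (if j' = j then 1 else 0) * c j') = (\<Sum>j'\<in>J. if j' = j then c j' else 0)"
      by (rule sum.cong) auto
    then show ?thesis using that assms(1) by simp
  qed
  \<comment> \<open>With no variables left the system reads \<open>0 \<le> c j\<close>, so unit
    vectors serve as multipliers.\<close>
  show ?case
    by (rule exI[of _ "(\<lambda>j j'. if j' = j then 1 else 0) ` J"]) (use assms(1) in \<open>auto simp: *\<close>)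
next
  case (insert k I)
  from insert.IH obtain \<N> where fin: "finite \<N>"
    and nzker: "\<forall>N\<in>\<N>. (\<exists>j\<in>J. N j > (0::nat)) \<and> (\<forall>i\<in>I. (\<Sum>j\<in>J. int (N j) * v j i) = 0)"
    and feas: "\<forall>c. (\<forall>N\<in>\<N>. 0 \<le> (\<Sum>j\<in>J. real (N j) * c j)) \<longrightarrow>
        (\<exists>y. \<forall>j\<in>J. 0 \<le> (\<Sum>i\<in>I. real_of_int (v j i) * y i) + c j)"
    by (elim exE conjE)
  have nz: "\<exists>j\<in>J. N j > 0" if "N \<in> \<N>" for N using nzker that by blast
  have ker: "(\<Sum>j\<in>J. int (N j) * v j i) = 0" if "N \<in> \<N>" "i \<in> I" for N i
    using nzker that by blast
  \<comment> \<open>\<open>w N\<close> is the coefficient of the eliminated coordinate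
    \<open>k\<close> in the combination \<open>N\<close>. A positive one yields a lower bound and a
    negative one an upper bound; \<open>comb\<close> scales such a pair so that the coefficients of
    \<open>k\<close> cancel.\<close>
  define w where "w N = (\<Sum>j\<in>J. int (N j) * v j k)" for N :: "'j \<Rightarrow> nat"
  define comb where "comb N N' j = nat (w N) * N' j + nat (- w N') * N j" for N N' :: "'j \<Rightarrow> nat" and j
  define \<N>' where "\<N>' = {N \<in> \<N>. w N = 0} \<union>
     (\<lambda>(N, N'). comb N N') ` ({N \<in> \<N>. w N > 0} \<times> {N \<in> \<N>. w N < 0})"
  have comb_int: "(\<Sum>j\<in>J. int (comb N N' j) * u j) =
      w N * (\<Sum>j\<in>J. int (N' j) * u j) - w N' * (\<Sum>j\<in>J. int (N j) * u j)"
    if "w N > 0" "w N' < 0" for N N' and u :: "'j \<Rightarrow> int"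
    using that by (simp add: comb_def sum_distrib_left algebra_simps sum.distrib sum_subtractf)
  have comb_real: "(\<Sum>j\<in>J. real (comb N N' j) * u j) =
      of_int (w N) * (\<Sum>j\<in>J. real (N' j) * u j) - of_int (w N') * (\<Sum>j\<in>J. real (N j) * u j)"
    if "w N > 0" "w N' < 0" for N N' and u :: "'j \<Rightarrow> real"
    using that by (simp add: comb_def sum_distrib_left algebra_simps sum.distrib sum_subtractf)
  have "finite \<N>'" using fin by (simp add: \<N>'_def)
  moreover have "\<exists>j\<in>J. N j > 0" if "N \<in> \<N>'" for N
  proof -
    have "\<exists>j\<in>J. comb N N' j > 0" if "N \<in> \<N>" "N' \<in> \<N>" "w N > 0" "w N' < 0" for N N'
      using nz[OF that(2)] that by (auto simp: comb_def)
    with that nz show ?thesis by (auto simp: \<N>'_def)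
  qed
  moreover have "(\<Sum>j\<in>J. int (N j) * v j i) = 0" if "N \<in> \<N>'" "i \<in> insert k I" for N i
  proof (cases "i = k")
    case True
    with that(1) show ?thesis by (auto simp: \<N>'_def comb_int) (auto simp: w_def)
  next
    case False
    with that show ?thesis by (auto simp: \<N>'_def comb_int ker)
  qed
  moreover have "\<exists>y. \<forall>j\<in>J. 0 \<le> (\<Sum>i\<in>insert k I. real_of_int (v j i) * y i) + c j"
    if c: "\<And>N. N \<in> \<N>' \<Longrightarrow> 0 \<le> (\<Sum>j\<in>J. real (N j) * c j)" for c
  proof -
    define h where "h N = (\<Sum>j\<in>J. real (N j) * c j)" for N
    \<comment> \<open>A lower bound lies below an upper bound precisely because the combination
      \<open>comb N N'\<close> of the constants is nonnegative.\<close>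
    have "\<exists>t. (\<forall>l\<in>(\<lambda>N. - h N / w N) ` {N \<in> \<N>. w N > 0}. l \<le> t) \<and>
        (\<forall>u\<in>(\<lambda>N. h N / (- w N)) ` {N \<in> \<N>. w N < 0}. t \<le> u)"
    proof (rule finite_sandwich)
      fix l u assume "l \<in> (\<lambda>N. - h N / w N) ` {N \<in> \<N>. w N > 0}" "u \<in> (\<lambda>N. h N / (- w N)) ` {N \<in> \<N>. w N < 0}"
      then obtain N N' where N: "N \<in> \<N>" "w N > 0" "l = - h N / w N"
        and N': "N' \<in> \<N>" "w N' < 0" "u = h N' / (- w N')" by auto
      have "comb N N' \<in> \<N>'" using N N' by (auto simp: \<N>'_def)
      from c[OF this] have "0 \<le> of_int (w N) * h N' - of_int (w N') * h N"
        using N N' by (simp add: comb_real h_def)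
      then show "l \<le> u" using N(2) N'(2) unfolding N(3) N'(3)
        by (simp add: divide_simps) (simp add: algebra_simps)
    qed (use fin in auto)
    then obtain t where lo: "\<And>N. N \<in> \<N> \<Longrightarrow> w N > 0 \<Longrightarrow> - h N / w N \<le> t"
      and up: "\<And>N. N \<in> \<N> \<Longrightarrow> w N < 0 \<Longrightarrow> t \<le> h N / (- w N)" by auto
    have wr: "(\<Sum>j\<in>J. real (N j) * (real_of_int (v j k) * t + c j)) = w N * t + h N" for N
      by (simp add: w_def h_def sum_distrib_right distrib_left sum.distrib mult.assoc)
    \<comment> \<open>With the value \<open>t\<close> inserted for coordinate \<open>k\<close>, its
      terms join the constants, and the induction hypothesis applies to these shifted
      constants.\<close>
    have "0 \<le> (\<Sum>j\<in>J. real (N j) * (real_of_int (v j k) * t + c j))" if N: "N \<in> \<N>" for N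
    proof -
      consider "w N = 0" | "w N > 0" | "w N < 0" by linarith
      then show ?thesis
      proof cases
        case 1
        then have "N \<in> \<N>'" using N by (auto simp: \<N>'_def)
        then show ?thesis unfolding wr using c 1 by (simp add: h_def)
      next
        case 2
        then show ?thesis unfolding wr using lo[OF N 2] by (simp add: field_simps)
      next
        case 3
        then show ?thesis unfolding wr using up[OF N 3] by (simp add: field_simps)
      qed
    qed
    then obtain y where
      y: "\<forall>j\<in>J. 0 \<le> (\<Sum>i\<in>I. real_of_int (v j i) * y i) + (real_of_int (v j k) * t + c j)"
      using feas[rule_format, of "\<lambda>j. real_of_int (v j k) * t + c j"] by blast
    have "(\<Sum>i\<in>insert k I. real_of_int (v j i) * (y(k := t)) i) =
        real_of_int (v j k) * t + (\<Sum>i\<in>I. real_of_int (v j i) * y i)" for j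
    proof -
      have "(\<Sum>i\<in>I. real_of_int (v j i) * (y(k := t)) i) = (\<Sum>i\<in>I. real_of_int (v j i) * y i)"
        by (rule sum.cong) (use insert.hyps in auto)
      then show ?thesis using insert.hyps by simp
    qed
    then show ?thesis using y by (intro exI[of _ "y(k := t)"]) (simp add: add.assoc add.commute add.left_commute)
  qed
  ultimately show ?case by (intro exI[of _ \<N>'] conjI ballI allI impI) blast+
qed

lemma fourier_motzkin:
  fixes v :: "'j \<Rightarrow> 'i::finite \<Rightarrow> int"
  assumes "finite J"
  obtains \<N> where "finite \<N>" "\<And>N. N \<in> \<N> \<Longrightarrow> \<exists>j\<in>J. N j > (0::nat)"
    "\<And>N i. N \<in> \<N> \<Longrightarrow> (\<Sum>j\<in>J. int (N j) * v j i) = 0"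
    "\<And>c. (\<And>N. N \<in> \<N> \<Longrightarrow> 0 \<le> (\<Sum>j\<in>J. real (N j) * c j)) \<Longrightarrow>
       \<exists>y. \<forall>j\<in>J. 0 \<le> (\<Sum>i\<in>UNIV. real_of_int (v j i) * y i) + c j"
proof -
  from fourier_motzkin_aux[OF assms finite_UNIV, of v] obtain \<N> where "finite \<N>"
    and nzker: "\<forall>N\<in>\<N>. (\<exists>j\<in>J. N j > (0::nat)) \<and> (\<forall>i\<in>UNIV. (\<Sum>j\<in>J. int (N j) * v j i) = 0)"
    and feas: "\<forall>c. (\<forall>N\<in>\<N>. 0 \<le> (\<Sum>j\<in>J. real (N j) * c j)) \<longrightarrow>
        (\<exists>y. \<forall>j\<in>J. 0 \<le> (\<Sum>i\<in>UNIV. real_of_int (v j i) * y i) + c j)"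
    by (elim exE conjE)
  then show ?thesis by (intro that[of \<N>]) blast+
qed

section \<open>Two forms of Farkas' lemma\<close>

text \<open>If all of the finitely many combinations were positive, they would stay nonnegative
  after lowering every constant by a small \<open>e\<close>, and a solution of the weak system so
  obtained would solve the strict one.\<close>

lemma farkas_strict:
  fixes v :: "'j \<Rightarrow> 'i::finite \<Rightarrow> int" and c :: "'j \<Rightarrow> real"
  assumes J: "finite J" and infeas: "\<nexists>y. \<forall>j\<in>J. 0 < (\<Sum>i\<in>UNIV. real_of_int (v j i) * y i) + c j"
  obtains N where "\<exists>j\<in>J. N j > (0::nat)" "\<And>i. (\<Sum>j\<in>J. int (N j) * v j i) = 0"
    "(\<Sum>j\<in>J. real (N j) * c j) \<le> 0"
proof -
  obtain \<N> where fin: "finite \<N>"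
    and nz: "\<And>N. N \<in> \<N> \<Longrightarrow> \<exists>j\<in>J. N j > (0::nat)"
    and ker: "\<And>N i. N \<in> \<N> \<Longrightarrow> (\<Sum>j\<in>J. int (N j) * v j i) = 0"
    and feas: "\<And>c. (\<And>N. N \<in> \<N> \<Longrightarrow> 0 \<le> (\<Sum>j\<in>J. real (N j) * c j)) \<Longrightarrow>
        \<exists>y. \<forall>j\<in>J. 0 \<le> (\<Sum>i\<in>UNIV. real_of_int (v j i) * y i) + c j"
    by (rule fourier_motzkin[OF J, of v]) blast
  have "\<exists>N\<in>\<N>. (\<Sum>j\<in>J. real (N j) * c j) \<le> 0"
  proof (rule ccontr)
    assume "\<not> ?thesis"
    then have pos: "\<And>N. N \<in> \<N> \<Longrightarrow> 0 < (\<Sum>j\<in>J. real (N j) * c j)" by force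
    define tot where "tot N = (\<Sum>j\<in>J. real (N j))" for N :: "'j \<Rightarrow> nat"
    have tot: "tot N > 0" if "N \<in> \<N>" for N
      unfolding tot_def using nz[OF that] J by (auto intro: sum_pos2)
    \<comment> \<open>Lowering each constant by \<open>e\<close> lowers the combination
      \<open>N\<close> by \<open>e * tot N\<close>. The entry 1 keeps the minimum defined when \<N>
      is empty.\<close>
    define e where "e = Min (insert 1 ((\<lambda>N. (\<Sum>j\<in>J. real (N j) * c j) / tot N) ` \<N>))"
    have "e > 0" unfolding e_def using fin pos tot by (subst Min_gr_iff) auto
    have "0 \<le> (\<Sum>j\<in>J. real (N j) * (c j - e))" if N: "N \<in> \<N>" for N
    proof -
      have "e \<le> (\<Sum>j\<in>J. real (N j) * c j) / tot N"
        unfolding e_def using fin N by (intro Min_le) auto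
      then have "e * tot N \<le> (\<Sum>j\<in>J. real (N j) * c j)" using tot[OF N] by (simp add: field_simps)
      then show ?thesis by (simp add: tot_def right_diff_distrib sum_subtractf sum_distrib_left mult.commute)
    qed
    from feas[OF this] obtain y where "\<forall>j\<in>J. 0 \<le> (\<Sum>i\<in>UNIV. real_of_int (v j i) * y i) + (c j - e)" ..
    then have "\<forall>j\<in>J. 0 < (\<Sum>i\<in>UNIV. real_of_int (v j i) * y i) + c j"
      using \<open>e > 0\<close> by force
    with infeas show False by blast
  qed
  with nz ker that show ?thesis by blast
qed

text \<open>The variable \<open>s\<close> homogenizes the constants. Since one finite set of
  multipliers serves every \<open>s\<close>, evaluation at \<open>s = 0\<close> or at a sufficiently
  large \<open>s\<close> produces the multiplier.\<close>

lemma farkas_homogeneous: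
  fixes v :: "'j \<Rightarrow> 'i::finite \<Rightarrow> int" and c :: "'j \<Rightarrow> real"
  assumes J: "finite J" "j\<^sub>0 \<in> J"
    and implied: "\<And>s y. 0 \<le> s \<Longrightarrow>
      (\<And>j. j \<in> J - {j\<^sub>0} \<Longrightarrow> 0 \<le> (\<Sum>i\<in>UNIV. real_of_int (v j i) * y i) + s * c j) \<Longrightarrow>
      (\<Sum>i\<in>UNIV. real_of_int (v j\<^sub>0 i) * y i) + s * c j\<^sub>0 \<le> 0"
  obtains N where "N j\<^sub>0 > (0::nat)" "\<And>i. (\<Sum>j\<in>J. int (N j) * v j i) = 0"
    "(\<Sum>j\<in>J. real (N j) * c j) \<le> 0"
proof -
  obtain \<N> where fin: "finite \<N>"
    and ker: "\<And>N i. N \<in> \<N> \<Longrightarrow> (\<Sum>j\<in>J. int (N j) * v j i) = 0"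
    and feas: "\<And>c. (\<And>N. N \<in> \<N> \<Longrightarrow> 0 \<le> (\<Sum>j\<in>J. real (N j) * c j)) \<Longrightarrow>
        \<exists>y. \<forall>j\<in>J. 0 \<le> (\<Sum>i\<in>UNIV. real_of_int (v j i) * y i) + c j"
    by (rule fourier_motzkin[OF J(1), of v]) blast
  define h where "h N = (\<Sum>j\<in>J. real (N j) * c j)" for N :: "'j \<Rightarrow> nat"
  \<comment> \<open>Otherwise the system with constants \<open>s * c j\<close>, lowered by 1 at
    \<open>j\<^sub>0\<close>, would be solvable, and a solution would make the form of
    \<open>j\<^sub>0\<close> at least 1, against \<open>implied\<close>.\<close>
  have ex: "\<exists>N\<in>\<N>. s * h N < N j\<^sub>0" if s: "0 \<le> s" for s
  proof (rule ccontr)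
    assume "\<not> ?thesis"
    then have *: "\<And>N. N \<in> \<N> \<Longrightarrow> N j\<^sub>0 \<le> s * h N" by force
    have sum: "(\<Sum>j\<in>J. real (N j) * (s * c j - (if j = j\<^sub>0 then 1 else 0))) = s * h N - N j\<^sub>0" for N
    proof -
      have "(\<Sum>j\<in>J. real (N j) * (s * c j - (if j = j\<^sub>0 then 1 else 0))) =
          (\<Sum>j\<in>J. s * (real (N j) * c j) - (if j = j\<^sub>0 then real (N j) else 0))"
        by (rule sum.cong) (auto simp: algebra_simps)
      then show ?thesis using J by (simp add: sum_subtractf h_def sum_distrib_left)
    qed
    have "\<exists>y. \<forall>j\<in>J. 0 \<le> (\<Sum>i\<in>UNIV. real_of_int (v j i) * y i) + (s * c j - (if j = j\<^sub>0 then 1 else 0))"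
      by (rule feas) (use * in \<open>auto simp: sum\<close>)
    then obtain y where y: "\<And>j. j \<in> J \<Longrightarrow>
      0 \<le> (\<Sum>i\<in>UNIV. real_of_int (v j i) * y i) + (s * c j - (if j = j\<^sub>0 then 1 else 0))" by blast
    have "(\<Sum>i\<in>UNIV. real_of_int (v j\<^sub>0 i) * y i) + s * c j\<^sub>0 \<le> 0"
    proof (rule implied[OF s])
      fix j assume "j \<in> J - {j\<^sub>0}"
      then show "0 \<le> (\<Sum>i\<in>UNIV. real_of_int (v j i) * y i) + s * c j" using y[of j] by simp
    qed
    with y[OF J(2)] show False by simp
  qed
  show ?thesis
  proof (cases "\<exists>N\<in>\<N>. h N < 0")
    case True
    then obtain N where N: "N \<in> \<N>" "h N < 0" by blast
    \<comment> \<open>\<open>N0\<close> is positive at \<open>j\<^sub>0\<close> but may have the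
      wrong sign on the constants; adding \<open>m\<close> copies of \<open>N\<close> repairs
      this.\<close>
    from ex[of 0] obtain N0 where N0: "N0 \<in> \<N>" "N0 j\<^sub>0 > 0" by auto
    define m where "m = nat \<lceil>h N0 / (- h N)\<rceil>"
    have "h N0 / (- h N) \<le> real m" unfolding m_def by linarith
    then have le: "h N0 + m * h N \<le> 0" using N(2) by (simp add: field_simps)
    show ?thesis
    proof (rule that[of "\<lambda>j. N0 j + m * N j"])
      show "0 < N0 j\<^sub>0 + m * N j\<^sub>0" using N0 by simp
      show "(\<Sum>j\<in>J. int (N0 j + m * N j) * v j i) = 0" for i
        using ker[OF N(1), of i] ker[OF N0(1), of i]
        by (simp add: distrib_right sum.distrib mult.assoc flip: sum_distrib_left)
      show "(\<Sum>j\<in>J. real (N0 j + m * N j) * c j) \<le> 0"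
        using le by (simp add: h_def distrib_right sum.distrib mult.assoc flip: sum_distrib_left)
    qed
  next
    case False
    \<comment> \<open>Once \<open>s\<close> is at least all these ratios,
      \<open>s * h N < N j\<^sub>0\<close> with \<open>h N \<ge> 0\<close> is possible only for
      \<open>h N = 0\<close>.\<close>
    define s where "s = Max (insert 0 ((\<lambda>N. N j\<^sub>0 / h N) ` \<N>))"
    have "0 \<le> s" unfolding s_def using fin by simp
    from ex[OF this] obtain N where N: "N \<in> \<N>" "s * h N < N j\<^sub>0" by blast
    have "N j\<^sub>0 / h N \<le> s" unfolding s_def using fin N by (intro Max_ge) auto
    moreover have "h N \<ge> 0" using False N(1) by force
    ultimately have "h N = 0" using N(2) by (cases "h N = 0") (auto simp: field_simps)
    then show ?thesis using N ker by (intro that[of N]) (auto simp: h_def)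
  qed
qed

section \<open>The semiring of tropical polynomials\<close>

lemma is_tpoly_nonneg: "is_tpoly P \<Longrightarrow> 0 \<le> P m"
  by (simp add: is_tpoly_def)

lemma is_tpoly_finite: "is_tpoly P \<Longrightarrow> finite {m. P m \<noteq> 0}"
  by (simp add: is_tpoly_def)

lemma is_tpoly_pos: "is_tpoly P \<Longrightarrow> P m \<noteq> 0 \<Longrightarrow> 0 < P m"
  by (metis is_tpoly_nonneg order_le_less)

section \<open>Products and powers as maxima over decompositions of exponents\<close>

lemma finite_exponents_below: "finite {a :: 'n::finite \<Rightarrow> nat. \<forall>i. a i \<le> m i}"
proof (rule finite_subset)
  show "finite {a :: 'n \<Rightarrow> nat. \<forall>x. (x \<in> UNIV \<longrightarrow> a x \<in> {..Max (range m)}) \<and> (x \<notin> UNIV \<longrightarrow> a x = 0)}"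
    by (rule finite_set_of_finite_funs) auto
  show "{a. \<forall>i. a i \<le> m i} \<subseteq> {a. \<forall>x. (x \<in> UNIV \<longrightarrow> a x \<in> {..Max (range m)}) \<and> (x \<notin> UNIV \<longrightarrow> a x = 0)}"
    by (auto intro: order_trans Max_ge)
qed

lemma finite_tpoly_mult_terms:
  fixes m :: "'n::finite \<Rightarrow> nat"
  shows "finite {P a * Q b | a b. (\<forall>i. a i + b i = m i)}"
proof (rule finite_subset)
  show "{P a * Q b | a b. (\<forall>i. a i + b i = m i)} \<subseteq>
      (\<lambda>(a, b). P a * Q b) ` ({a. \<forall>i. a i \<le> m i} \<times> {b. \<forall>i. b i \<le> m i})"
  proof
    fix z assume "z \<in> {P a * Q b | a b. (\<forall>i. a i + b i = m i)}"
    then obtain a b where z: "z = P a * Q b" and ab: "\<forall>i. a i + b i = m i" by blast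
    have "a i \<le> m i" "b i \<le> m i" for i by (metis ab le_add1, metis ab le_add2)
    then show "z \<in> (\<lambda>(a, b). P a * Q b) ` ({a. \<forall>i. a i \<le> m i} \<times> {b. \<forall>i. b i \<le> m i})"
      by (intro image_eqI[of _ _ "(a, b)"]) (auto simp: z)
  qed
qed (use finite_exponents_below[of m] in auto)

lemma tpoly_mult_nonneg: "0 \<le> tpoly_mult P Q (m :: 'n::finite \<Rightarrow> nat)"
  unfolding tpoly_mult_def using finite_tpoly_mult_terms[of P Q m] by (intro Max_ge) auto

lemma tpoly_mult_ge: "P a * Q b \<le> tpoly_mult P Q (\<lambda>i::'n::finite. a i + b i)"
  unfolding tpoly_mult_def using finite_tpoly_mult_terms[of P Q "\<lambda>i. a i + b i"]
  by (intro Max_ge) auto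

text \<open>Addition is maximum, so a nonzero coefficient of a product is one of its terms. This
  takes the place of manipulating sums.\<close>

lemma tpoly_mult_cases:
  fixes m :: "'n::finite \<Rightarrow> nat"
  obtains "tpoly_mult P Q m = 0"
  | a b where "m = (\<lambda>i. a i + b i)" "tpoly_mult P Q m = P a * Q b"
proof -
  have "tpoly_mult P Q m \<in> insert 0 {P a * Q b | a b. (\<forall>i. a i + b i = m i)}"
    unfolding tpoly_mult_def using finite_tpoly_mult_terms[of P Q m] by (intro Max_in) auto
  then consider "tpoly_mult P Q m = 0"
    | a b where "\<forall>i. a i + b i = m i" "tpoly_mult P Q m = P a * Q b" by blast
  then show ?thesis
  proof cases
    case (2 a b)
    then have "m = (\<lambda>i. a i + b i)" by auto
    then show ?thesis using 2(2) by (rule that(2))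
  qed (rule that(1))
qed

lemma tpoly_mult_leI:
  fixes m :: "'n::finite \<Rightarrow> nat"
  assumes "0 \<le> c" "\<And>a b. m = (\<lambda>i. a i + b i) \<Longrightarrow> P a * Q b \<le> c"
  shows "tpoly_mult P Q m \<le> c"
  by (cases rule: tpoly_mult_cases[of P Q m]) (use assms in auto)

lemma tpoly_mult_commute: "tpoly_mult P Q = tpoly_mult Q P"
proof
  fix m
  have "{P a * Q b | a b. (\<forall>i. a i + b i = m i)} = {Q a * P b | a b. (\<forall>i. a i + b i = m i)}"
    by (metis (no_types, lifting) add.commute mult.commute)
  then show "tpoly_mult P Q m = tpoly_mult Q P m" by (simp add: tpoly_mult_def)
qed

lemma tpoly_mult_mono:
  fixes P :: "'n::finite tpoly"
  assumes "is_tpoly P" "is_tpoly Q" "P \<le> P'" "Q \<le> Q'"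
  shows "tpoly_mult P Q \<le> tpoly_mult P' Q'"
proof (rule le_funI, rule tpoly_mult_leI)
  fix m a b :: "'n \<Rightarrow> nat" assume m: "m = (\<lambda>i. a i + b i)"
  have "P a * Q b \<le> P' a * Q' b"
    using assms by (intro mult_mono) (auto simp: le_fun_def is_tpoly_nonneg intro: order_trans[OF is_tpoly_nonneg])
  then show "P a * Q b \<le> tpoly_mult P' Q' m"
    unfolding m using tpoly_mult_ge by (rule order_trans)
qed (rule tpoly_mult_nonneg)

lemma is_tpoly_mult:
  fixes P :: "'n::finite tpoly"
  assumes "is_tpoly P" "is_tpoly Q"
  shows "is_tpoly (tpoly_mult P Q)"
proof -
  have "{m. tpoly_mult P Q m \<noteq> 0} \<subseteq> (\<lambda>(a, b) i. a i + b i) ` ({m. P m \<noteq> 0} \<times> {m. Q m \<noteq> 0})"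
  proof
    fix m assume "m \<in> {m. tpoly_mult P Q m \<noteq> 0}"
    then show "m \<in> (\<lambda>(a, b) i. a i + b i) ` ({m. P m \<noteq> 0} \<times> {m. Q m \<noteq> 0})"
      by (cases rule: tpoly_mult_cases[of P Q m]) force+
  qed
  then have "finite {m. tpoly_mult P Q m \<noteq> 0}"
    by (rule finite_subset) (use assms in \<open>auto simp: is_tpoly_finite\<close>)
  then show ?thesis by (simp add: is_tpoly_def tpoly_mult_nonneg)
qed

lemma tpoly_mult_assoc_le:
  fixes P :: "'n::finite tpoly"
  assumes "is_tpoly P" "is_tpoly Q" "is_tpoly R"
  shows "tpoly_mult (tpoly_mult P Q) R \<le> tpoly_mult P (tpoly_mult Q R)"
proof (rule le_funI, rule tpoly_mult_leI)
  fix m u c :: "'n \<Rightarrow> nat" assume m: "m = (\<lambda>i. u i + c i)"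
  show "tpoly_mult P Q u * R c \<le> tpoly_mult P (tpoly_mult Q R) m"
  proof (cases rule: tpoly_mult_cases[of P Q u])
    case 1
    then show ?thesis by (simp add: tpoly_mult_nonneg)
  next
    case (2 a b)
    have "tpoly_mult P Q u * R c = P a * (Q b * R c)" by (simp add: 2(2))
    also have "\<dots> \<le> P a * tpoly_mult Q R (\<lambda>i. b i + c i)"
      by (rule mult_left_mono[OF tpoly_mult_ge is_tpoly_nonneg[OF assms(1)]])
    also have "\<dots> \<le> tpoly_mult P (tpoly_mult Q R) (\<lambda>i. a i + (b i + c i))"
      by (rule tpoly_mult_ge)
    finally show ?thesis by (simp add: m 2(1) add.assoc)
  qed
qed (rule tpoly_mult_nonneg)

lemma tpoly_mult_assoc:
  fixes P :: "'n::finite tpoly"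
  assumes "is_tpoly P" "is_tpoly Q" "is_tpoly R"
  shows "tpoly_mult (tpoly_mult P Q) R = tpoly_mult P (tpoly_mult Q R)"
proof (rule order_antisym)
  \<comment> \<open>By commutativity the inequality for \<open>R\<close>, \<open>Q\<close>,
    \<open>P\<close> is the reverse of the one for \<open>P\<close>, \<open>Q\<close>,
    \<open>R\<close>.\<close>
  show "tpoly_mult P (tpoly_mult Q R) \<le> tpoly_mult (tpoly_mult P Q) R"
    using tpoly_mult_assoc_le[OF assms(3,2,1)]
    by (metis tpoly_mult_commute)
qed (rule tpoly_mult_assoc_le[OF assms])

lemma is_tpoly_one: "is_tpoly tpoly_one"
  by (simp add: is_tpoly_def tpoly_one_def)

lemma is_tpoly_zero: "is_tpoly tpoly_zero"
  by (simp add: is_tpoly_def tpoly_zero_def)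

lemma tpoly_mult_one:
  fixes P :: "'n::finite tpoly"
  assumes "is_tpoly P"
  shows "tpoly_mult tpoly_one P = P"
proof (rule order_antisym; rule le_funI)
  fix m
  show "tpoly_mult tpoly_one P m \<le> P m"
    by (rule tpoly_mult_leI) (use assms in \<open>auto simp: tpoly_one_def is_tpoly_nonneg\<close>)
  show "P m \<le> tpoly_mult tpoly_one P m"
    using tpoly_mult_ge[of tpoly_one "\<lambda>i. 0" P m] by (simp add: tpoly_one_def)
qed

lemma tpoly_mult_zero: "tpoly_mult P tpoly_zero = (tpoly_zero :: 'n::finite tpoly)"
proof
  fix m show "tpoly_mult P tpoly_zero m = (tpoly_zero m :: real)"
    by (cases rule: tpoly_mult_cases[of P tpoly_zero m]) (auto simp: tpoly_zero_def)
qed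

lemma tpoly_mult_nonzero:
  fixes P :: "'n::finite tpoly"
  assumes "is_tpoly P" "is_tpoly Q" "P \<noteq> tpoly_zero" "Q \<noteq> tpoly_zero"
  shows "tpoly_mult P Q \<noteq> tpoly_zero"
proof -
  from assms(3,4) obtain a b where "P a \<noteq> 0" "Q b \<noteq> 0" by (auto simp: tpoly_zero_def fun_eq_iff)
  then have "0 < P a * Q b" using assms by (simp add: is_tpoly_pos)
  also have "\<dots> \<le> tpoly_mult P Q (\<lambda>i. a i + b i)" by (rule tpoly_mult_ge)
  finally show ?thesis by (metis less_irrefl tpoly_zero_def)
qed

lemma tpoly_one_nonzero: "tpoly_one \<noteq> tpoly_zero"
  by (auto simp: tpoly_one_def tpoly_zero_def fun_eq_iff)

lemma is_tpoly_pow: "is_tpoly P \<Longrightarrow> is_tpoly (tpoly_pow P k :: 'n::finite tpoly)"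
  by (induction k) (auto simp: is_tpoly_one is_tpoly_mult)

lemma tpoly_pow_nonzero:
  "is_tpoly P \<Longrightarrow> P \<noteq> tpoly_zero \<Longrightarrow> tpoly_pow P k \<noteq> (tpoly_zero :: 'n::finite tpoly)"
  by (induction k) (auto simp: tpoly_one_nonzero tpoly_mult_nonzero is_tpoly_pow)

lemma tpoly_pow_mono:
  fixes P :: "'n::finite tpoly"
  shows "is_tpoly P \<Longrightarrow> P \<le> Q \<Longrightarrow> tpoly_pow P k \<le> tpoly_pow Q k"
  by (induction k) (simp_all add: tpoly_mult_mono is_tpoly_pow)

lemma tpoly_pow_add_ge:
  fixes P :: "'n::finite tpoly"
  assumes P: "is_tpoly P"
  shows "tpoly_pow P k u * tpoly_pow P l v \<le> tpoly_pow P (k + l) (\<lambda>i. u i + v i)"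
proof (induction k arbitrary: u)
  case 0
  then show ?case by (auto simp: tpoly_one_def is_tpoly_nonneg[OF is_tpoly_pow[OF P]])
next
  case (Suc k)
  show ?case
  proof (cases rule: tpoly_mult_cases[of P "tpoly_pow P k" u])
    case 1
    then show ?thesis by (simp add: tpoly_mult_nonneg)
  next
    case (2 p q)
    have "tpoly_pow P (Suc k) u * tpoly_pow P l v = P p * (tpoly_pow P k q * tpoly_pow P l v)"
      by (simp add: 2(2))
    also have "\<dots> \<le> P p * tpoly_pow P (k + l) (\<lambda>i. q i + v i)"
      by (rule mult_left_mono[OF Suc is_tpoly_nonneg[OF P]])
    also have "\<dots> \<le> tpoly_mult P (tpoly_pow P (k + l)) (\<lambda>i. p i + (q i + v i))"
      by (rule tpoly_mult_ge)
    finally show ?thesis by (simp add: 2(1) add.assoc)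
  qed
qed

lemma tpoly_pow_single_ge:
  fixes P :: "'n::finite tpoly"
  assumes P: "is_tpoly P"
  shows "P m ^ k \<le> tpoly_pow P k (\<lambda>i. k * m i)"
proof (induction k)
  case 0
  then show ?case by (simp add: tpoly_one_def)
next
  case (Suc k)
  have "P m ^ Suc k \<le> P m * tpoly_pow P k (\<lambda>i. k * m i)"
    using Suc P by (simp add: mult_left_mono is_tpoly_nonneg)
  also have "\<dots> \<le> tpoly_mult P (tpoly_pow P k) (\<lambda>i. m i + k * m i)" by (rule tpoly_mult_ge)
  finally show ?case by simp
qed

text \<open>Carries a Farkas combination into a power of \<open>P\<close>: taking the monomial
  \<open>m\<close> as a factor \<open>N m\<close> times gives one term of the expansion.\<close>

lemma tpoly_pow_prod_ge:
  fixes P :: "'n::finite tpoly"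
  assumes P: "is_tpoly P" and "finite J"
  shows "(\<Prod>m\<in>J. P m ^ N m) \<le> tpoly_pow P (\<Sum>m\<in>J. N m) (\<lambda>i. \<Sum>m\<in>J. N m * m i)"
  using assms(2)
proof (induction J rule: finite_induct)
  case empty
  then show ?case by (simp add: tpoly_one_def)
next
  case (insert m J)
  have "(\<Prod>m\<in>insert m J. P m ^ N m) = P m ^ N m * (\<Prod>m\<in>J. P m ^ N m)"
    using insert by simp
  also have "\<dots> \<le> tpoly_pow P (N m) (\<lambda>i. N m * m i) *
      tpoly_pow P (\<Sum>m\<in>J. N m) (\<lambda>i. \<Sum>m\<in>J. N m * m i)"
    using P by (intro mult_mono insert tpoly_pow_single_ge)
      (auto intro!: prod_nonneg simp: is_tpoly_nonneg is_tpoly_pow)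
  also have "\<dots> \<le> tpoly_pow P (N m + (\<Sum>m\<in>J. N m)) (\<lambda>i. N m * m i + (\<Sum>m\<in>J. N m * m i))"
    by (rule tpoly_pow_add_ge[OF P])
  finally show ?case using insert by simp
qed

section \<open>Equality in the quotient semiring\<close>

lemma tpoly_equiv_refl: "tpoly_equiv P P"
  unfolding tpoly_equiv_def using is_tpoly_one tpoly_one_nonzero by blast

lemma tpoly_equiv_sym: "tpoly_equiv P Q \<Longrightarrow> tpoly_equiv Q P"
  unfolding tpoly_equiv_def by (elim exE conjE) (intro exI conjI, auto)

lemma tpoly_equiv_trans:
  fixes P :: "'n::finite tpoly"
  assumes tp: "is_tpoly P" "is_tpoly Q" "is_tpoly R" and "tpoly_equiv P Q" "tpoly_equiv Q R"
  shows "tpoly_equiv P R"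
proof -
  from assms(4,5) obtain A B where A: "is_tpoly A" "A \<noteq> tpoly_zero" "tpoly_mult A P = tpoly_mult A Q"
    and B: "is_tpoly B" "B \<noteq> tpoly_zero" "tpoly_mult B Q = tpoly_mult B R"
    by (auto simp: tpoly_equiv_def)
  have "tpoly_mult (tpoly_mult A B) P = tpoly_mult B (tpoly_mult A P)"
    by (metis A(1) B(1) tp(1) tpoly_mult_assoc tpoly_mult_commute)
  also have "\<dots> = tpoly_mult A (tpoly_mult B Q)"
    unfolding A(3) by (metis A(1) B(1) tp(2) tpoly_mult_assoc tpoly_mult_commute)
  also have "\<dots> = tpoly_mult (tpoly_mult A B) R"
    unfolding B(3) by (simp add: A B tp tpoly_mult_assoc)
  finally show ?thesis
    unfolding tpoly_equiv_def
    using is_tpoly_mult[OF A(1) B(1)] tpoly_mult_nonzero[OF A(1) B(1) A(2) B(2)] by blast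
qed

text \<open>If the \<open>N\<close>-th power of the monomial \<open>M = c X\<^sup>m\<close> is dominated by \<open>A\<^sup>N\<close>, then
  \<open>(A + M)\<^sup>N = A (A + M)\<^bsup>N - 1\<^esup>\<close>, because the only term of the expansion without a factor \<open>A\<close> is \<open>M\<^sup>N\<close>.\<close>

lemma tpoly_equiv_absorb_monomial:
  fixes A :: "'n::finite tpoly"
  assumes A: "is_tpoly A" and c: "0 < c" and N: "1 \<le> N"
    and le: "c ^ N \<le> tpoly_pow A N (\<lambda>i. N * m i)"
  shows "tpoly_equiv A (A(m := max (A m) c))"
proof -
  define S where "S = A(m := max (A m) c)"
  have "{u. S u \<noteq> 0} \<subseteq> insert m {u. A u \<noteq> 0}" by (auto simp: S_def)
  then have "finite {u. S u \<noteq> 0}" using is_tpoly_finite[OF A] by (simp add: finite_subset)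
  moreover have "0 \<le> S u" for u using A c by (auto simp: S_def is_tpoly_nonneg le_max_iff_disj)
  ultimately have S: "is_tpoly S" by (simp add: is_tpoly_def)
  have "S m \<noteq> 0" using c by (auto simp: S_def)
  then have Snz: "S \<noteq> tpoly_zero" by (auto simp: tpoly_zero_def)
  have AS: "A \<le> S" by (auto simp: S_def le_fun_def)
  \<comment> \<open>Peel off one factor \<open>S\<close>. If it contributes a coefficient of
    \<open>A\<close>, the second entry of the maximum bounds the term; otherwise it is the new
    monomial, and induction applies to the remaining factors.\<close>
  have expand: "tpoly_pow S (Suc j) u \<le>
      max (if u = (\<lambda>i. Suc j * m i) then c ^ Suc j else 0) (tpoly_mult A (tpoly_pow S j) u)" for j u
  proof (induction j arbitrary: u)
    case 0
    have "tpoly_mult S tpoly_one = S" "tpoly_mult A tpoly_one = A"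
      using A S tpoly_mult_one tpoly_mult_commute by metis+
    moreover have "S u \<le> max (if u = m then c else 0) (A u)" by (auto simp: S_def)
    ultimately show ?case by (auto split: if_splits)
  next
    case (Suc j)
    let ?rhs = "max (if u = (\<lambda>i. Suc (Suc j) * m i) then c ^ Suc (Suc j) else 0)
        (tpoly_mult A (tpoly_pow S (Suc j)) u)"
    have "tpoly_mult S (tpoly_pow S (Suc j)) u \<le> ?rhs"
    proof (rule tpoly_mult_leI)
      show "0 \<le> ?rhs" by (rule max.coboundedI2) (rule tpoly_mult_nonneg)
      fix p q assume u: "u = (\<lambda>i. p i + q i)"
      show "S p * tpoly_pow S (Suc j) q \<le> ?rhs"
      proof (cases "S p = A p")
        case True
        then show ?thesis unfolding u by (intro max.coboundedI2) (metis tpoly_mult_ge)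
      next
        case False
        then have p: "p = m" "S m = c" by (auto simp: S_def split: if_splits)
        consider "tpoly_pow S (Suc j) q \<le> (if q = (\<lambda>i. Suc j * m i) then c ^ Suc j else 0)"
          | "tpoly_pow S (Suc j) q \<le> tpoly_mult A (tpoly_pow S j) q"
          using Suc.IH[of q] by (auto simp only: le_max_iff_disj)
        then show ?thesis
        proof cases
          case 1
          then have "c * tpoly_pow S (Suc j) q \<le> c * (if q = (\<lambda>i. Suc j * m i) then c ^ Suc j else 0)"
            using c by (intro mult_left_mono) auto
          also have "\<dots> \<le> (if u = (\<lambda>i. Suc (Suc j) * m i) then c ^ Suc (Suc j) else 0)"
            using c by (auto simp: u p fun_eq_iff)
          finally show ?thesis unfolding p by (intro max.coboundedI1)
        next
          case 2
          \<comment> \<open>The factor \<open>A\<close> found among the others moves to the front,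
            and the new monomial joins the power of \<open>S\<close>.\<close>
          have "c * tpoly_mult A (tpoly_pow S j) q \<le> tpoly_mult A (tpoly_pow S (Suc j)) u"
          proof (cases rule: tpoly_mult_cases[of A "tpoly_pow S j" q])
            case 1
            then show ?thesis by (simp only: mult_zero_right tpoly_mult_nonneg)
          next
            case (2 x z)
            have "c * tpoly_mult A (tpoly_pow S j) q = A x * (S m * tpoly_pow S j z)"
              by (simp add: 2(2) p)
            also have "\<dots> \<le> A x * tpoly_pow S (Suc j) (\<lambda>i. m i + z i)"
              unfolding tpoly_pow.simps by (rule mult_left_mono[OF tpoly_mult_ge is_tpoly_nonneg[OF A]])
            also have "\<dots> \<le> tpoly_mult A (tpoly_pow S (Suc j)) (\<lambda>i. x i + (m i + z i))"
              by (rule tpoly_mult_ge)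
            finally show ?thesis by (simp only: u p 2(1) add.left_commute)
          qed
          moreover have "c * tpoly_pow S (Suc j) q \<le> c * tpoly_mult A (tpoly_pow S j) q"
            using 2 c by (intro mult_left_mono) auto
          ultimately show ?thesis unfolding p by (intro max.coboundedI2) linarith
        qed
      qed
    qed
    then show ?case by simp
  qed
  obtain j where j: "N = Suc j" using N by (cases N) auto
  \<comment> \<open>By \<open>le\<close> the pure power of the new monomial lies below the
    \<open>N\<close>-th power of \<open>A\<close>, hence below \<open>A\<close> times the power of
    \<open>S\<close>. So \<open>tpoly_pow S j\<close> becomes the witness of the
    equivalence.\<close>
  have powle: "tpoly_pow A N \<le> tpoly_mult A (tpoly_pow S j)"
    unfolding j tpoly_pow.simps using A AS by (intro tpoly_mult_mono is_tpoly_pow tpoly_pow_mono) auto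
  have "tpoly_mult S (tpoly_pow S j) u \<le> tpoly_mult A (tpoly_pow S j) u" for u
  proof (cases "u = (\<lambda>i. N * m i)")
    case True
    have "c ^ N \<le> tpoly_mult A (tpoly_pow S j) u"
      unfolding True using le powle by (auto simp: le_fun_def intro: order_trans)
    then show ?thesis using expand[of j u] True by (simp add: j)
  next
    case False
    then have "max (if u = (\<lambda>i. Suc j * m i) then c ^ Suc j else 0) (tpoly_mult A (tpoly_pow S j) u)
      = tpoly_mult A (tpoly_pow S j) u" by (simp add: j tpoly_mult_nonneg)
    then show ?thesis using expand[of j u] by simp
  qed
  then have "tpoly_mult S (tpoly_pow S j) \<le> tpoly_mult A (tpoly_pow S j)" by (rule le_funI)
  moreover have "tpoly_mult A (tpoly_pow S j) \<le> tpoly_mult S (tpoly_pow S j)"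
    using A S AS by (simp add: tpoly_mult_mono is_tpoly_pow)
  ultimately have "tpoly_mult S (tpoly_pow S j) = tpoly_mult A (tpoly_pow S j)" by (rule order_antisym)
  then have "tpoly_mult (tpoly_pow S j) A = tpoly_mult (tpoly_pow S j) S"
    by (simp add: tpoly_mult_commute)
  then show ?thesis
    unfolding tpoly_equiv_def S_def[symmetric] using S Snz is_tpoly_pow tpoly_pow_nonzero by blast
qed

section \<open>Polynomial functions\<close>

text \<open>The entry 0 is the value of the zero polynomial; it does not exceed any term when
  coefficients and coordinates are nonnegative.\<close>

definition tpoly_eval :: "'n::finite tpoly \<Rightarrow> ('n \<Rightarrow> real) \<Rightarrow> real" where
  "tpoly_eval A x = Max (insert 0 ((\<lambda>m. A m * mono_val x m) ` {m. A m \<noteq> 0}))"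

lemma mono_val_nonneg: "(\<And>i. 0 \<le> x i) \<Longrightarrow> 0 \<le> mono_val x m"
  by (simp add: mono_val_def prod_nonneg)

lemma mono_val_add: "mono_val x (\<lambda>i. a i + b i) = mono_val x a * mono_val x b"
  by (simp add: mono_val_def power_add prod.distrib)

lemma tpoly_eval_ge:
  assumes "is_tpoly A" "\<And>i. 0 \<le> x i"
  shows "A m * mono_val x m \<le> tpoly_eval A x"
proof (cases "A m = 0")
  case True
  then show ?thesis using is_tpoly_finite[OF assms(1)] by (simp add: tpoly_eval_def)
next
  case False
  then show ?thesis using is_tpoly_finite[OF assms(1)] by (auto simp: tpoly_eval_def intro!: Max_ge)
qed

lemma tpoly_eval_nonneg: "is_tpoly A \<Longrightarrow> 0 \<le> tpoly_eval A x"
  by (simp add: tpoly_eval_def is_tpoly_finite)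

lemma tpoly_eval_leI:
  assumes "is_tpoly A" "0 \<le> c" "\<And>m. A m \<noteq> 0 \<Longrightarrow> A m * mono_val x m \<le> c"
  shows "tpoly_eval A x \<le> c"
  using assms is_tpoly_finite[OF assms(1)] by (auto simp: tpoly_eval_def)

lemma tpoly_eval_attained:
  assumes "is_tpoly A"
  obtains "tpoly_eval A x = 0" | m where "A m \<noteq> 0" "tpoly_eval A x = A m * mono_val x m"
proof -
  have "tpoly_eval A x \<in> insert 0 ((\<lambda>m. A m * mono_val x m) ` {m. A m \<noteq> 0})"
    unfolding tpoly_eval_def using is_tpoly_finite[OF assms] by (intro Max_in) auto
  with that show ?thesis by blast
qed

lemma tpoly_eval_mono:
  assumes "is_tpoly A" "is_tpoly B" "A \<le> B" "\<And>i. 0 \<le> x i"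
  shows "tpoly_eval A x \<le> tpoly_eval B x"
proof (rule tpoly_eval_leI[OF assms(1)])
  fix m
  have "A m * mono_val x m \<le> B m * mono_val x m"
    using assms by (intro mult_right_mono mono_val_nonneg) (auto simp: le_fun_def)
  also have "\<dots> \<le> tpoly_eval B x" using assms by (intro tpoly_eval_ge)
  finally show "A m * mono_val x m \<le> tpoly_eval B x" .
qed (rule tpoly_eval_nonneg[OF assms(2)])

lemma tpoly_eval_mult:
  assumes A: "is_tpoly A" and B: "is_tpoly B" and x: "\<And>i. 0 \<le> x i"
  shows "tpoly_eval (tpoly_mult A B) x = tpoly_eval A x * tpoly_eval B x"
proof (rule order_antisym)
  have nn: "0 \<le> tpoly_eval A x" "0 \<le> tpoly_eval B x" using A B by (auto intro: tpoly_eval_nonneg)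
  have prod: "A a * B b * mono_val x (\<lambda>i. a i + b i) = (A a * mono_val x a) * (B b * mono_val x b)" for a b
    by (simp add: mono_val_add)
  show "tpoly_eval (tpoly_mult A B) x \<le> tpoly_eval A x * tpoly_eval B x"
  proof (rule tpoly_eval_leI[OF is_tpoly_mult[OF A B]])
    fix m assume "tpoly_mult A B m \<noteq> 0"
    then obtain a b where m: "m = (\<lambda>i. a i + b i)" and ab: "tpoly_mult A B m = A a * B b"
      by (cases rule: tpoly_mult_cases[of A B m]) auto
    show "tpoly_mult A B m * mono_val x m \<le> tpoly_eval A x * tpoly_eval B x"
      unfolding ab unfolding m prod
      by (rule mult_mono[OF tpoly_eval_ge[OF A x] tpoly_eval_ge[OF B x] nn(1)])
        (rule mult_nonneg_nonneg[OF is_tpoly_nonneg[OF B] mono_val_nonneg[OF x]])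
  qed (use nn in simp)
  have tp: "is_tpoly (tpoly_mult A B)" using A B by (rule is_tpoly_mult)
  show "tpoly_eval A x * tpoly_eval B x \<le> tpoly_eval (tpoly_mult A B) x"
  proof (cases rule: tpoly_eval_attained[OF A, of x])
    case 1
    then show ?thesis using tpoly_eval_nonneg[OF tp] by simp
  next
    case (2 a)
    note a = 2
    show ?thesis
    proof (cases rule: tpoly_eval_attained[OF B, of x])
      case 1
      then show ?thesis using tpoly_eval_nonneg[OF tp] by simp
    next
      case (2 b)
      have "A a * B b * mono_val x (\<lambda>i. a i + b i) \<le>
          tpoly_mult A B (\<lambda>i. a i + b i) * mono_val x (\<lambda>i. a i + b i)"
        by (rule mult_right_mono[OF tpoly_mult_ge mono_val_nonneg[OF x]])
      also have "\<dots> \<le> tpoly_eval (tpoly_mult A B) x" by (intro tpoly_eval_ge tp x)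
      finally show ?thesis unfolding prod by (simp add: a(2) 2(2))
    qed
  qed
qed

lemma tpoly_eval_one: "tpoly_eval tpoly_one x = 1"
proof -
  have "{m. tpoly_one m \<noteq> 0} = {\<lambda>i. 0}" by (auto simp: tpoly_one_def)
  then show ?thesis by (simp add: tpoly_eval_def) (simp add: tpoly_one_def mono_val_def)
qed

lemma tpoly_eval_pow:
  assumes "is_tpoly A" "\<And>i. 0 \<le> x i"
  shows "tpoly_eval (tpoly_pow A k) x = tpoly_eval A x ^ k"
  by (induction k) (auto simp: tpoly_eval_one tpoly_eval_mult assms is_tpoly_pow)

text \<open>A finite maximum of continuous functions is continuous. This carries identities to
  boundary points of the orthant and from dense sets to all points.\<close>

lemma tendsto_tpoly_eval:
  assumes A: "is_tpoly A" and X: "\<And>i. (\<lambda>n. X n i) \<longlonglongrightarrow> x i"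
  shows "(\<lambda>n. tpoly_eval A (X n)) \<longlonglongrightarrow> tpoly_eval A x"
proof -
  have "(\<lambda>n. Max (insert 0 ((\<lambda>m. A m * mono_val (X n) m) ` S))) \<longlonglongrightarrow>
      Max (insert 0 ((\<lambda>m. A m * mono_val x m) ` S))" if "finite S" for S
    using that
  proof (induction S rule: finite_induct)
    case (insert a S)
    have 1: "Max (insert 0 ((\<lambda>m. A m * mono_val z m) ` insert a S)) =
        max (A a * mono_val z a) (Max (insert 0 ((\<lambda>m. A m * mono_val z m) ` S)))" for z
      using insert.hyps by (subst image_insert, subst insert_commute, subst Max_insert) auto
    have "(\<lambda>n. A a * mono_val (X n) a) \<longlonglongrightarrow> A a * mono_val x a"
      unfolding mono_val_def by (intro tendsto_intros X)
    then show ?case unfolding 1 using insert.IH by (rule tendsto_max)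
  qed simp
  then show ?thesis unfolding tpoly_eval_def using is_tpoly_finite[OF A] by blast
qed

section \<open>Logarithmic coordinates and absorption of dominated polynomials\<close>

text \<open>For positive \<open>A m\<close> this is the logarithm of the monomial at the point with
  coordinates \<open>exp (y i)\<close>, an affine function of \<open>y\<close>.\<close>

definition log_val :: "'n::finite tpoly \<Rightarrow> ('n \<Rightarrow> nat) \<Rightarrow> ('n \<Rightarrow> real) \<Rightarrow> real" where
  "log_val A m y = ln (A m) + (\<Sum>i\<in>UNIV. real (m i) * y i)"

lemma mono_val_exp: "mono_val (\<lambda>i. exp (y i)) m = exp (\<Sum>i\<in>UNIV. real (m i) * y i)"
  by (simp add: mono_val_def exp_sum exp_of_nat_mult)

lemma exp_log_val:
  assumes "is_tpoly A" "A m \<noteq> 0"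
  shows "A m * mono_val (\<lambda>i. exp (y i)) m = exp (log_val A m y)"
  using is_tpoly_pos[OF assms] by (simp add: log_val_def mono_val_exp exp_add)

text \<open>No \<open>y\<close> puts the monomial strictly above all monomials of \<open>A\<close>,
  so \<open>farkas_strict\<close> gives multiplicities under which the exponents of \<open>A\<close>
  average to \<open>m\<close> and the logarithms of its coefficients average to at least
  \<open>ln c\<close>. Exponentiating yields a term of a power of \<open>A\<close>.\<close>

lemma tpoly_pow_dominates_monomial:
  fixes A :: "'n::finite tpoly"
  assumes A: "is_tpoly A" and c: "0 < c"
    and le: "\<And>y. c * mono_val (\<lambda>i. exp (y i)) m \<le> tpoly_eval A (\<lambda>i. exp (y i))"
  obtains N where "1 \<le> N" "c ^ N \<le> tpoly_pow A N (\<lambda>i. N * m i)"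
proof -
  define J where "J = {m. A m \<noteq> 0}"
  have J: "finite J" using is_tpoly_finite[OF A] by (simp add: J_def)
  have "\<nexists>y. \<forall>j\<in>J. 0 < (\<Sum>i\<in>UNIV. real_of_int (int (m i) - int (j i)) * y i) + (ln c - ln (A j))"
  proof
    assume "\<exists>y. \<forall>j\<in>J. 0 < (\<Sum>i\<in>UNIV. real_of_int (int (m i) - int (j i)) * y i) + (ln c - ln (A j))"
    then obtain y where y: "\<And>j. j \<in> J \<Longrightarrow>
      0 < (\<Sum>i\<in>UNIV. real_of_int (int (m i) - int (j i)) * y i) + (ln c - ln (A j))" by blast
    have *: "c * mono_val (\<lambda>i. exp (y i)) m = exp (ln c + (\<Sum>i\<in>UNIV. real (m i) * y i))"
      using c by (simp add: mono_val_exp exp_add)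
    have "tpoly_eval A (\<lambda>i. exp (y i)) < c * mono_val (\<lambda>i. exp (y i)) m"
    proof (cases rule: tpoly_eval_attained[OF A, of "\<lambda>i. exp (y i)"])
      case 1
      then show ?thesis using c by (simp add: mono_val_exp)
    next
      case (2 j)
      have "0 < (\<Sum>i\<in>UNIV. real (m i) * y i) - (\<Sum>i\<in>UNIV. real (j i) * y i) + (ln c - ln (A j))"
        using y[of j] 2 by (simp add: J_def left_diff_distrib sum_subtractf)
      then show ?thesis using 2 exp_log_val[OF A 2(1), of y] by (simp add: * log_val_def)
    qed
    with le[of y] show False by simp
  qed
  from farkas_strict[OF J this] obtain N where nz: "\<exists>j\<in>J. N j > 0"
    and ker: "\<And>i. (\<Sum>j\<in>J. int (N j) * (int (m i) - int (j i))) = 0"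
    and lec: "(\<Sum>j\<in>J. real (N j) * (ln c - ln (A j))) \<le> 0" by blast
  \<comment> \<open>The sum of the multiplicities is the power sought.\<close>
  define K where "K = (\<Sum>j\<in>J. N j)"
  have "1 \<le> K" unfolding K_def using nz J by (metis One_nat_def Suc_leI sum_pos2 zero_le)
  have expo: "(\<lambda>i. \<Sum>j\<in>J. N j * j i) = (\<lambda>i. K * m i)"
  proof
    fix i
    have "int (\<Sum>j\<in>J. N j * j i) = int (K * m i)"
      using ker[of i] by (simp add: K_def right_diff_distrib sum_subtractf sum_distrib_right)
    then show "(\<Sum>j\<in>J. N j * j i) = K * m i" by linarith
  qed
  have "real K * ln c \<le> (\<Sum>j\<in>J. real (N j) * ln (A j))"
    using lec by (simp add: K_def right_diff_distrib sum_subtractf sum_distrib_right)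
  then have "exp (real K * ln c) \<le> exp (\<Sum>j\<in>J. real (N j) * ln (A j))" by simp
  also have "exp (\<Sum>j\<in>J. real (N j) * ln (A j)) = (\<Prod>j\<in>J. A j ^ N j)"
    unfolding exp_sum[OF J]
    by (rule prod.cong) (auto simp: J_def exp_of_nat_mult is_tpoly_pos[OF A])
  also have "\<dots> \<le> tpoly_pow A K (\<lambda>i. K * m i)"
    using tpoly_pow_prod_ge[OF A J, of N] by (simp add: expo K_def)
  finally have "c ^ K \<le> tpoly_pow A K (\<lambda>i. K * m i)" using c by (simp add: exp_of_nat_mult)
  with \<open>1 \<le> K\<close> show ?thesis by (rule that)
qed

text \<open>The monomials of \<open>B\<close> are adjoined to \<open>A\<close> one by one; each lies
  below the polynomial reached so far and is absorbed. In the proof \<open>F\<close> holds the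
  exponents already treated.\<close>

lemma tpoly_equiv_max:
  fixes A B :: "'n::finite tpoly"
  assumes A: "is_tpoly A" and B: "is_tpoly B"
    and le: "\<And>y. tpoly_eval B (\<lambda>i. exp (y i)) \<le> tpoly_eval A (\<lambda>i. exp (y i))"
  shows "tpoly_equiv A (\<lambda>m. max (A m) (B m))"
proof -
  define S where "S F m = (if m \<in> F then max (A m) (B m) else A m)" for F m
  have S: "is_tpoly (S F)" for F
  proof -
    have "{m. S F m \<noteq> 0} \<subseteq> {m. A m \<noteq> 0} \<union> {m. B m \<noteq> 0}" by (auto simp: S_def max_def)
    then have "finite {m. S F m \<noteq> 0}"
      by (rule finite_subset) (use A B in \<open>simp add: is_tpoly_finite\<close>)
    moreover have "0 \<le> S F m" for m using A by (auto simp: S_def is_tpoly_nonneg le_max_iff_disj)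
    ultimately show ?thesis by (simp add: is_tpoly_def)
  qed
  have "tpoly_equiv A (S F)" if "finite F" "F \<subseteq> {m. B m \<noteq> 0}" for F
    using that
  proof (induction F rule: finite_induct)
    case empty
    have "S {} = A" by (auto simp: S_def)
    then show ?case by (simp add: tpoly_equiv_refl)
  next
    case (insert m F)
    have Bm: "0 < B m" using insert.prems is_tpoly_pos[OF B] by auto
    have "B m * mono_val (\<lambda>i. exp (y i)) m \<le> tpoly_eval (S F) (\<lambda>i. exp (y i))" for y
    proof -
      have "B m * mono_val (\<lambda>i. exp (y i)) m \<le> tpoly_eval B (\<lambda>i. exp (y i))"
        by (rule tpoly_eval_ge[OF B]) simp
      also have "\<dots> \<le> tpoly_eval A (\<lambda>i. exp (y i))" by (rule le)
      also have "\<dots> \<le> tpoly_eval (S F) (\<lambda>i. exp (y i))"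
        by (rule tpoly_eval_mono[OF A S]) (auto simp: S_def le_fun_def)
      finally show ?thesis .
    qed
    from tpoly_pow_dominates_monomial[OF S Bm this] obtain N where
      "1 \<le> N" "B m ^ N \<le> tpoly_pow (S F) N (\<lambda>i. N * m i)" by blast
    from tpoly_equiv_absorb_monomial[OF S Bm this]
    have "tpoly_equiv (S F) ((S F)(m := max (S F m) (B m)))" .
    moreover have "(S F)(m := max (S F m) (B m)) = S (insert m F)"
      using insert.hyps by (intro ext) (auto simp: S_def)
    ultimately have step: "tpoly_equiv (S F) (S (insert m F))" by simp
    have "tpoly_equiv A (S F)" using insert.IH insert.prems by simp
    then show ?case using step by (rule tpoly_equiv_trans[OF A S S])
  qed
  from this[OF is_tpoly_finite[OF B]] have "tpoly_equiv A (S {m. B m \<noteq> 0})" by simp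
  moreover have "S {m. B m \<noteq> 0} = (\<lambda>m. max (A m) (B m))"
    by (intro ext) (auto simp: S_def max_absorb1 is_tpoly_nonneg[OF A])
  ultimately show ?thesis by simp
qed

text \<open>Each of the two is equivalent to their tropical sum.\<close>

lemma tpoly_equiv_if_eval_eq:
  fixes A B :: "'n::finite tpoly"
  assumes A: "is_tpoly A" and B: "is_tpoly B"
    and eq: "\<And>y. tpoly_eval A (\<lambda>i. exp (y i)) = tpoly_eval B (\<lambda>i. exp (y i))"
  shows "tpoly_equiv A B"
proof -
  have "{m. max (A m) (B m) \<noteq> 0} \<subseteq> {m. A m \<noteq> 0} \<union> {m. B m \<noteq> 0}" by (auto simp: max_def)
  then have "finite {m. max (A m) (B m) \<noteq> 0}"
    by (rule finite_subset) (use A B in \<open>simp add: is_tpoly_finite\<close>)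
  then have tp: "is_tpoly (\<lambda>m. max (A m) (B m))"
    using A by (auto simp: is_tpoly_def le_max_iff_disj)
  have "tpoly_equiv A (\<lambda>m. max (A m) (B m))" by (rule tpoly_equiv_max[OF A B]) (simp add: eq)
  moreover have "tpoly_equiv B (\<lambda>m. max (B m) (A m))" by (rule tpoly_equiv_max[OF B A]) (simp add: eq)
  then have "tpoly_equiv (\<lambda>m. max (A m) (B m)) B"
    by (simp add: tpoly_equiv_sym max.commute)
  ultimately show ?thesis by (rule tpoly_equiv_trans[OF A tp B])
qed

section \<open>Zeros of divisors\<close>

text \<open>The value of the multiplier \<open>W\<close> is positive at points with positive
  coordinates and cancels there. It may vanish on the boundary, which is reached by
  continuity.\<close>

lemma tpoly_equiv_eval_eq:
  fixes A B :: "'n::finite tpoly"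
  assumes A: "is_tpoly A" and B: "is_tpoly B" and "tpoly_equiv A B" and x: "\<And>i. 0 \<le> x i"
  shows "tpoly_eval A x = tpoly_eval B x"
proof -
  from assms(3) obtain W where W: "is_tpoly W" "W \<noteq> tpoly_zero" "tpoly_mult W A = tpoly_mult W B"
    by (auto simp: tpoly_equiv_def)
  from W(2) obtain w where w: "W w \<noteq> 0" by (auto simp: tpoly_zero_def fun_eq_iff)
  have pos: "tpoly_eval A z = tpoly_eval B z" if z: "\<And>i. 0 < z i" for z
  proof -
    have z0: "0 \<le> z i" for i using z[of i] by simp
    have "0 < W w * mono_val z w" using is_tpoly_pos[OF W(1) w] z by (simp add: mono_val_def prod_pos)
    also have "\<dots> \<le> tpoly_eval W z" by (rule tpoly_eval_ge[OF W(1) z0])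
    finally have "tpoly_eval W z \<noteq> 0" by simp
    moreover have "tpoly_eval W z * tpoly_eval A z = tpoly_eval W z * tpoly_eval B z"
      using W(3) tpoly_eval_mult[OF W(1) A, of z, OF z0] tpoly_eval_mult[OF W(1) B, of z, OF z0] by auto
    ultimately show ?thesis by simp
  qed
  define X where "X n i = x i + inverse (real (Suc n))" for n i
  have "(\<lambda>n. X n i) \<longlonglongrightarrow> x i" for i
    unfolding X_def using tendsto_add[OF tendsto_const[of "x i"] LIMSEQ_inverse_real_of_nat] by simp
  then have "(\<lambda>n. tpoly_eval A (X n)) \<longlonglongrightarrow> tpoly_eval A x" "(\<lambda>n. tpoly_eval B (X n)) \<longlonglongrightarrow> tpoly_eval B x"
    by (auto intro: tendsto_tpoly_eval[OF A] tendsto_tpoly_eval[OF B])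
  moreover have "tpoly_eval A (X n) = tpoly_eval B (X n)" for n
    by (rule pos) (simp add: X_def add_nonneg_pos x)
  ultimately show ?thesis by (simp add: LIMSEQ_unique)
qed

text \<open>The support is finite, so the maximum is attained; the value 0, or a second monomial
  attaining the maximum, would make \<open>x\<close> a zero.\<close>

lemma not_is_tzero_iff:
  assumes A: "is_tpoly A" and x: "\<And>i. 0 \<le> x i"
  shows "\<not> is_tzero A x \<longleftrightarrow>
    (\<exists>b. 0 < A b * mono_val x b \<and> (\<forall>c. c \<noteq> b \<longrightarrow> A c * mono_val x c < A b * mono_val x b))"
proof
  have nn: "0 \<le> A m * mono_val x m" for m
    by (rule mult_nonneg_nonneg[OF is_tpoly_nonneg[OF A] mono_val_nonneg[OF x]])
  assume nz: "\<not> is_tzero A x"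
  then obtain m where "A m * mono_val x m \<noteq> 0" by (auto simp: is_tzero_def)
  with nn[of m] have "0 < A m * mono_val x m" by linarith
  also have "\<dots> \<le> tpoly_eval A x" by (rule tpoly_eval_ge[OF A x])
  finally have pos: "0 < tpoly_eval A x" .
  then obtain b where b: "A b \<noteq> 0" "tpoly_eval A x = A b * mono_val x b"
    by (cases rule: tpoly_eval_attained[OF A, of x]) auto
  have max: "A c * mono_val x c \<le> A b * mono_val x b" for c
    using tpoly_eval_ge[OF A, of x c, OF x] by (simp add: b)
  have "A c * mono_val x c < A b * mono_val x b" if "c \<noteq> b" for c
  proof (rule ccontr)
    assume "\<not> ?thesis"
    with max[of c] have eq: "A b * mono_val x b = A c * mono_val x c" by simp
    then have "A c \<noteq> 0" using pos b by auto
    with b(1) eq max that have "is_tzero A x"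
      unfolding is_tzero_def by (intro disjI2 exI[of _ b] exI[of _ c]) auto
    with nz show False ..
  qed
  with pos b show "\<exists>b. 0 < A b * mono_val x b \<and> (\<forall>c. c \<noteq> b \<longrightarrow> A c * mono_val x c < A b * mono_val x b)"
    by auto
next
  assume "\<exists>b. 0 < A b * mono_val x b \<and> (\<forall>c. c \<noteq> b \<longrightarrow> A c * mono_val x c < A b * mono_val x b)"
  then obtain b where b: "0 < A b * mono_val x b"
    "\<And>c. c \<noteq> b \<Longrightarrow> A c * mono_val x c < A b * mono_val x b" by blast
  show "\<not> is_tzero A x"
  proof
    assume "is_tzero A x"
    then consider "A b * mono_val x b = 0"
      | p q where "p \<noteq> q" "A p * mono_val x p = A q * mono_val x q"
          "A b * mono_val x b \<le> A p * mono_val x p"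
      unfolding is_tzero_def by blast
    then show False
    proof cases
      case 1
      with b(1) show False by simp
    next
      case 2
      then have "p = b" using b(2)[of p] by force
      moreover have "q = b" using 2 b(2)[of q] by force
      ultimately show False using 2(1) by simp
    qed
  qed
qed

text \<open>Near a point where \<open>Q\<close> has a single dominating monomial, \<open>P R = Q\<^sup>k\<close> is log-linear. Moving in the
  direction \<open>a - a'\<close> and back shows that any two dominating monomials \<open>a, a'\<close> of \<open>P\<close> have the same
  slope in that direction, hence coincide.\<close>

lemma tvar_subset_of_dvd_pow:
  fixes P Q :: "'n::finite tpoly"
  assumes P: "is_tpoly P" and Q: "is_tpoly Q" and dvd: "tpoly_dvd P (tpoly_pow Q k)"
  shows "tvar P \<subseteq> tvar Q"
proof (rule subsetI, rule ccontr)
  fix x assume "x \<in> tvar P" "x \<notin> tvar Q"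
  then have x: "0 \<le> x i" and xP: "is_tzero P x" and xQ: "\<not> is_tzero Q x" for i
    by (auto simp: tvar_def)
  from dvd obtain R where R: "is_tpoly R" and equiv: "tpoly_equiv (tpoly_pow Q k) (tpoly_mult P R)"
    by (auto simp: tpoly_dvd_def)
  have eval: "tpoly_eval Q z ^ k = tpoly_eval P z * tpoly_eval R z" if z: "\<And>i. 0 \<le> z i" for z
    using tpoly_equiv_eval_eq[OF is_tpoly_pow[OF Q] is_tpoly_mult[OF P R] equiv, of z, OF z]
    by (simp add: tpoly_eval_pow[OF Q, of z, OF z] tpoly_eval_mult[OF P R, of z, OF z])
  from xQ obtain b where b: "0 < Q b * mono_val x b"
    "\<And>c. c \<noteq> b \<Longrightarrow> Q c * mono_val x c < Q b * mono_val x b"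
    unfolding not_is_tzero_iff[OF Q x] by blast
  have Qx: "tpoly_eval Q x = Q b * mono_val x b"
  proof (rule order_antisym)
    show "tpoly_eval Q x \<le> Q b * mono_val x b"
      by (rule tpoly_eval_leI[OF Q]) (use b in \<open>force intro: less_imp_le\<close>)+
  qed (rule tpoly_eval_ge[OF Q x])
  define V where "V = tpoly_eval Q x ^ k"
  have V: "0 < V" "V = tpoly_eval P x * tpoly_eval R x"
    unfolding V_def by (simp add: Qx b(1)) (rule eval[of x, OF x])
  then have "tpoly_eval P x \<noteq> 0" "tpoly_eval R x \<noteq> 0" by auto
  then obtain r where r: "tpoly_eval R x = R r * mono_val x r"
    by (cases rule: tpoly_eval_attained[OF R, of x]) auto
  obtain e where e: "P e * mono_val x e \<noteq> 0" "tpoly_eval P x = P e * mono_val x e"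
    using \<open>tpoly_eval P x \<noteq> 0\<close> by (cases rule: tpoly_eval_attained[OF P, of x]) auto
  from xP e(1) obtain a a' where aa: "a \<noteq> a'" "P a * mono_val x a = P a' * mono_val x a'"
    and "P e * mono_val x e \<le> P a * mono_val x a"
    unfolding is_tzero_def by blast
  with tpoly_eval_ge[OF P, of x a, OF x] have Pa: "tpoly_eval P x = P a * mono_val x a" by (simp add: e(2))
  with aa have Pa': "tpoly_eval P x = P a' * mono_val x a'" by simp
  \<comment> \<open>The curve \<open>z\<close> scales the coordinates of \<open>x\<close> by
    \<open>exp (t * d i)\<close>. It keeps zero coordinates zero, so boundary points are covered as
    well; the monomial \<open>m\<close> grows at rate \<open>s m\<close>.\<close>
  define d where "d i = real (a i) - real (a' i)" for i
  define s where "s m = (\<Sum>i\<in>UNIV. real (m i) * d i)" for m :: "'n \<Rightarrow> nat"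
  define z where "z t i = x i * exp (t * d i)" for t i
  have z: "0 \<le> z t i" for t i by (simp add: z_def x)
  have mono_z: "mono_val (z t) m = mono_val x m * exp (t * s m)" for t m
  proof -
    have "mono_val (z t) m = mono_val x m * (\<Prod>i\<in>UNIV. exp (t * d i) ^ m i)"
      by (simp add: mono_val_def z_def power_mult_distrib prod.distrib)
    also have "(\<Prod>i\<in>UNIV. exp (t * d i) ^ m i) = exp (t * s m)"
      by (simp add: s_def exp_sum sum_distrib_left flip: exp_of_nat_mult) (simp add: mult.left_commute)
    finally show ?thesis .
  qed
  have "eventually (\<lambda>t. \<forall>c\<in>{c. Q c \<noteq> 0} - {b}. Q c * mono_val (z t) c < Q b * mono_val (z t) b) (nhds 0)"
  proof (rule eventually_ball_finite)
    show "\<forall>c\<in>{c. Q c \<noteq> 0} - {b}. eventually (\<lambda>t. Q c * mono_val (z t) c < Q b * mono_val (z t) b) (nhds 0)"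
    proof
      fix c assume "c \<in> {c. Q c \<noteq> 0} - {b}"
      then have "c \<noteq> b" by simp
      define g where "g t = Q b * mono_val (z t) b - Q c * mono_val (z t) c" for t
      have "isCont g 0" unfolding g_def mono_z by (intro continuous_intros)
      then have "(g \<longlongrightarrow> g 0) (nhds 0)" by (simp add: continuous_at tendsto_at_iff_tendsto_nhds)
      moreover have "0 < g 0" using b(2)[OF \<open>c \<noteq> b\<close>] by (simp add: g_def mono_z)
      ultimately have "eventually (\<lambda>t. 0 < g t) (nhds 0)" by (rule order_tendstoD(1))
      then show "eventually (\<lambda>t. Q c * mono_val (z t) c < Q b * mono_val (z t) b) (nhds 0)"
        by (simp add: g_def)
    qed
  qed (use is_tpoly_finite[OF Q] in simp)
  then obtain \<epsilon> where \<epsilon>: "0 < \<epsilon>" and dom: "\<And>t c. \<bar>t\<bar> < \<epsilon> \<Longrightarrow> Q c \<noteq> 0 \<Longrightarrow> c \<noteq> b \<Longrightarrow>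
      Q c * mono_val (z t) c < Q b * mono_val (z t) b"
    by (auto simp: eventually_nhds_metric dist_real_def)
  \<comment> \<open>At \<open>t = 0\<close> the product of the terms \<open>p\<close> and
    \<open>r\<close> equals \<open>V\<close>; along the curve it stays below the \<open>k\<close>-th
    power of the term \<open>b\<close>, so the rates compare. Opposite signs of \<open>t\<close>
    then give equality.\<close>
  have slope: "t * (s p + s r) \<le> t * (real k * s b)"
    if t: "\<bar>t\<bar> < \<epsilon>" and p: "tpoly_eval P x = P p * mono_val x p" for t p
  proof -
    have "tpoly_eval Q (z t) \<le> Q b * mono_val (z t) b"
    proof (rule tpoly_eval_leI[OF Q])
      show "0 \<le> Q b * mono_val (z t) b"
        by (rule mult_nonneg_nonneg[OF is_tpoly_nonneg[OF Q] mono_val_nonneg[OF z]])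
      show "Q m * mono_val (z t) m \<le> Q b * mono_val (z t) b" if "Q m \<noteq> 0" for m
        using dom[OF t that] by (cases "m = b") auto
    qed
    then have "tpoly_eval Q (z t) ^ k \<le> (tpoly_eval Q x * exp (t * s b)) ^ k"
      by (intro power_mono tpoly_eval_nonneg[OF Q]) (simp add: Qx mono_z)
    also have "\<dots> = V * exp (t * (real k * s b))"
      by (simp add: V_def power_mult_distrib mult.left_commute flip: exp_of_nat_mult)
    finally have up: "tpoly_eval P (z t) * tpoly_eval R (z t) \<le> V * exp (t * (real k * s b))"
      by (simp add: eval[of "z t", OF z])
    have "V * exp (t * (s p + s r)) = (P p * mono_val (z t) p) * (R r * mono_val (z t) r)"
      by (simp add: V(2) p r mono_z exp_add distrib_left)
    also have "\<dots> \<le> tpoly_eval P (z t) * tpoly_eval R (z t)"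
      by (rule mult_mono[OF tpoly_eval_ge[OF P z] tpoly_eval_ge[OF R z] tpoly_eval_nonneg[OF P]])
        (rule mult_nonneg_nonneg[OF is_tpoly_nonneg[OF R] mono_val_nonneg[OF z]])
    finally have "V * exp (t * (s p + s r)) \<le> V * exp (t * (real k * s b))" using up by simp
    then show ?thesis using V(1) by simp
  qed
  have "s p + s r = real k * s b" if "tpoly_eval P x = P p * mono_val x p" for p
    using slope[of "\<epsilon> / 2" p] slope[of "- \<epsilon> / 2" p] that \<epsilon> by simp
  from this[OF Pa] this[OF Pa'] have "s a = s a'" by simp
  \<comment> \<open>The difference \<open>s a - s a'\<close> is the squared length of
    \<open>d\<close>.\<close>
  moreover have "d i * d i = real (a i) * d i - real (a' i) * d i" for i
    by (simp add: d_def left_diff_distrib)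
  ultimately have "(\<Sum>i\<in>UNIV. d i * d i) = 0" by (simp add: s_def sum_subtractf)
  then have "d i * d i = 0" for i by (subst (asm) sum_nonneg_eq_0_iff) auto
  then have "a = a'" by (auto simp: d_def)
  with aa(1) show False ..
qed

section \<open>Cells of linearity\<close>

text \<open>For a polynomial \<open>A\<close> these \<open>y\<close> form the open convex cell of
  \<open>b\<close>, on which \<open>A\<close> is a single affine function in logarithmic
  coordinates.\<close>

definition dominates :: "'n::finite tpoly \<Rightarrow> ('n \<Rightarrow> nat) \<Rightarrow> ('n \<Rightarrow> real) \<Rightarrow> bool" where
  "dominates A b y \<longleftrightarrow> A b \<noteq> 0 \<and> (\<forall>c. A c \<noteq> 0 \<longrightarrow> c \<noteq> b \<longrightarrow> log_val A c y < log_val A b y)"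

lemma dominates_nonzero: "dominates A b y \<Longrightarrow> A b \<noteq> 0"
  by (simp add: dominates_def)

lemma dominates_le: "dominates A b y \<Longrightarrow> A c \<noteq> 0 \<Longrightarrow> log_val A c y \<le> log_val A b y"
  by (cases "c = b") (auto simp: dominates_def intro: less_imp_le)

lemma dominates_less: "dominates A b y \<Longrightarrow> A c \<noteq> 0 \<Longrightarrow> c \<noteq> b \<Longrightarrow> log_val A c y < log_val A b y"
  by (simp add: dominates_def)

lemma not_is_tzero_exp_iff:
  assumes A: "is_tpoly A"
  shows "\<not> is_tzero A (\<lambda>i. exp (y i)) \<longleftrightarrow> (\<exists>b. dominates A b y)"
proof -
  have "0 < A b * mono_val (\<lambda>i. exp (y i)) b \<longleftrightarrow> A b \<noteq> 0" for b
    using is_tpoly_pos[OF A, of b] by (auto simp: mono_val_exp)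
  moreover have "A c * mono_val (\<lambda>i. exp (y i)) c < A b * mono_val (\<lambda>i. exp (y i)) b \<longleftrightarrow>
      (A c \<noteq> 0 \<longrightarrow> log_val A c y < log_val A b y)" if "A b \<noteq> 0" for b c
    using that is_tpoly_pos[OF A that]
    by (cases "A c = 0") (simp_all add: exp_log_val[OF A])
  ultimately show ?thesis
    unfolding dominates_def by (subst not_is_tzero_iff[OF A]) auto
qed

lemma tpoly_eval_dominates:
  assumes A: "is_tpoly A" and b: "dominates A b y"
  shows "tpoly_eval A (\<lambda>i. exp (y i)) = exp (log_val A b y)"
proof (rule order_antisym)
  show "tpoly_eval A (\<lambda>i. exp (y i)) \<le> exp (log_val A b y)"
    by (rule tpoly_eval_leI[OF A]) (auto simp: exp_log_val[OF A] dominates_le[OF b])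
  show "exp (log_val A b y) \<le> tpoly_eval A (\<lambda>i. exp (y i))"
    using tpoly_eval_ge[OF A, of "\<lambda>i. exp (y i)" b] by (simp add: exp_log_val[OF A dominates_nonzero[OF b]])
qed

lemma log_val_segment:
  "log_val A m (\<lambda>i. (1 - t) * y i + t * z i) = (1 - t) * log_val A m y + t * log_val A m z"
  by (simp add: log_val_def algebra_simps sum.distrib sum_subtractf sum_distrib_left)

lemma log_val_line:
  "log_val A m (\<lambda>i. y i + t * d i) = log_val A m y + t * (\<Sum>i\<in>UNIV. real (m i) * d i)"
  by (simp add: log_val_def algebra_simps sum.distrib sum_distrib_left)

lemma dominates_segment:
  assumes "dominates A b y" "dominates A b z" "0 \<le> t" "t \<le> 1"
  shows "dominates A b (\<lambda>i. (1 - t) * y i + t * z i)"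
  unfolding dominates_def
proof (intro conjI allI impI)
  show "A b \<noteq> 0" using assms(1) by (rule dominates_nonzero)
  fix c assume c: "A c \<noteq> 0" "c \<noteq> b"
  have 1: "0 < log_val A b y - log_val A c y" "0 < log_val A b z - log_val A c z"
    using dominates_less[OF assms(1) c] dominates_less[OF assms(2) c] by auto
  have "0 < (1 - t) * (log_val A b y - log_val A c y) + t * (log_val A b z - log_val A c z)"
  proof (cases "t = 0")
    case False
    then have "0 < t * (log_val A b z - log_val A c z)" using 1 assms(3) by simp
    moreover have "0 \<le> (1 - t) * (log_val A b y - log_val A c y)" using 1 assms(4) by simp
    ultimately show ?thesis by linarith
  qed (use 1 in simp)
  then show "log_val A c (\<lambda>i. (1 - t) * y i + t * z i) < log_val A b (\<lambda>i. (1 - t) * y i + t * z i)"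
    unfolding log_val_segment by (simp add: algebra_simps)
qed

text \<open>Otherwise, at the first point of the segment where \<open>a\<close> is caught up by another monomial, the maximum
  is attained twice.\<close>

lemma dominates_along_segment:
  assumes P: "is_tpoly P" and y: "dominates P a y"
    and seg: "\<And>t. 0 \<le> t \<Longrightarrow> t \<le> 1 \<Longrightarrow> \<exists>e. dominates P e (\<lambda>i. (1 - t) * y i + t * z i)"
  shows "dominates P a z"
proof (rule ccontr)
  assume "\<not> dominates P a z"
  \<comment> \<open>Signed heights of \<open>c\<close> above \<open>a\<close> at the two ends of the
    segment. \<open>C\<close> collects the monomials that have caught up by the end, and
    \<open>\<tau> c\<close> is the time at which the interpolated height vanishes.\<close>
  define \<alpha> where "\<alpha> c = log_val P c y - log_val P a y" for c
  define \<beta> where "\<beta> c = log_val P c z - log_val P a z" for c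
  have Pa: "P a \<noteq> 0" using y by (rule dominates_nonzero)
  have \<alpha>: "\<alpha> c < 0" if "P c \<noteq> 0" "c \<noteq> a" for c
    using dominates_less[OF y that] by (simp add: \<alpha>_def)
  define C where "C = {c. P c \<noteq> 0 \<and> c \<noteq> a \<and> 0 \<le> \<beta> c}"
  have finC: "finite C" by (rule finite_subset[OF _ is_tpoly_finite[OF P]]) (auto simp: C_def)
  have "C \<noteq> {}" using \<open>\<not> dominates P a z\<close> Pa by (auto simp: dominates_def C_def \<beta>_def not_less)
  define \<tau> where "\<tau> c = \<alpha> c / (\<alpha> c - \<beta> c)" for c
  define t where "t = Min (\<tau> ` C)"
  have "t \<in> \<tau> ` C" unfolding t_def using finC \<open>C \<noteq> {}\<close> by (intro Min_in) auto
  then obtain e where e: "e \<in> C" "t = \<tau> e" by blast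
  have \<tau>: "0 \<le> \<tau> c" "\<tau> c \<le> 1" "\<alpha> c + \<tau> c * (\<beta> c - \<alpha> c) = 0" if "c \<in> C" for c
  proof -
    have "\<alpha> c < 0" "0 \<le> \<beta> c" using that \<alpha> by (auto simp: C_def)
    then show "0 \<le> \<tau> c" "\<tau> c \<le> 1" "\<alpha> c + \<tau> c * (\<beta> c - \<alpha> c) = 0"
      by (auto simp: \<tau>_def field_simps)
  qed
  have t: "0 \<le> t" "t \<le> 1" using \<tau>[OF e(1)] e(2) by auto
  let ?z = "\<lambda>i. (1 - t) * y i + t * z i"
  have val: "log_val P c ?z - log_val P a ?z = \<alpha> c + t * (\<beta> c - \<alpha> c)" for c
    unfolding log_val_segment by (simp add: \<alpha>_def \<beta>_def algebra_simps)
  \<comment> \<open>At the earliest crossing time \<open>a\<close> is still maximal but tied with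
    \<open>e\<close>, so no monomial can dominate there.\<close>
  have le: "log_val P c ?z \<le> log_val P a ?z" if c: "P c \<noteq> 0" for c
  proof -
    consider "c = a" | "c \<noteq> a" "\<beta> c < 0" | "c \<in> C" using c unfolding C_def by force
    then have "\<alpha> c + t * (\<beta> c - \<alpha> c) \<le> 0"
    proof cases
      case 1
      then show ?thesis by (simp add: \<alpha>_def \<beta>_def)
    next
      case 2
      have "\<alpha> c + t * (\<beta> c - \<alpha> c) = (1 - t) * \<alpha> c + t * \<beta> c" by (simp add: algebra_simps)
      moreover have "(1 - t) * \<alpha> c \<le> 0" "t * \<beta> c \<le> 0"
        using t 2 \<alpha>[OF c 2(1)] by (auto intro: mult_nonneg_nonpos)
      ultimately show ?thesis by linarith
    next
      case 3
      then have "t \<le> \<tau> c" unfolding t_def using finC by (intro Min_le) auto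
      moreover have "0 \<le> \<beta> c - \<alpha> c" using 3 \<alpha>[of c] by (auto simp: C_def)
      ultimately have "t * (\<beta> c - \<alpha> c) \<le> \<tau> c * (\<beta> c - \<alpha> c)" by (rule mult_right_mono)
      then show ?thesis using \<tau>(3)[OF 3] by linarith
    qed
    then show ?thesis using val[of c] by linarith
  qed
  from seg[OF t] obtain p where p: "dominates P p ?z" ..
  have "p = a"
  proof (rule ccontr)
    assume "p \<noteq> a"
    then have "log_val P a ?z < log_val P p ?z" using dominates_less[OF p Pa] by simp
    with le[OF dominates_nonzero[OF p]] show False by simp
  qed
  moreover have "P e \<noteq> 0" "e \<noteq> a" using e(1) by (auto simp: C_def)
  ultimately have "log_val P e ?z < log_val P a ?z" using dominates_less[OF p] by simp
  with val[of e] \<tau>(3)[OF e(1)] show False by (simp add: e(2))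
qed

section \<open>Density of the points with a dominating monomial\<close>

text \<open>A direction \<open>d\<close> that is good for \<open>F\<close> is perturbed by a
  multiple \<epsilon> of \<open>v\<close>. Each form vanishes for at most one \<epsilon>, including
  that of \<open>v\<close> itself because \<open>v\<close> has positive squared length.\<close>

lemma generic_direction:
  fixes F :: "('n::finite \<Rightarrow> int) set"
  assumes "finite F" "\<And>v. v \<in> F \<Longrightarrow> v \<noteq> (\<lambda>i. 0)"
  shows "\<exists>d::'n \<Rightarrow> real. \<forall>v\<in>F. (\<Sum>i\<in>UNIV. of_int (v i) * d i) \<noteq> 0"
  using assms
proof (induction F rule: finite_induct)
  case (insert v F)
  then obtain d :: "'n \<Rightarrow> real" where d: "\<And>u. u \<in> F \<Longrightarrow> (\<Sum>i\<in>UNIV. of_int (u i) * d i) \<noteq> 0" by auto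
  define p where "p u = (\<Sum>i\<in>UNIV. real_of_int (u i) * d i)" for u
  define q where "q u = (\<Sum>i\<in>UNIV. real_of_int (u i) * real_of_int (v i))" for u
  have "finite ((\<lambda>u. - p u / q u) ` insert v F)" using insert.hyps by simp
  then obtain \<epsilon> :: real where \<epsilon>: "\<epsilon> \<notin> (\<lambda>u. - p u / q u) ` insert v F"
    using ex_new_if_finite[OF infinite_UNIV_char_0] by blast
  have lin: "(\<Sum>i\<in>UNIV. real_of_int (u i) * (d i + \<epsilon> * real_of_int (v i))) = p u + \<epsilon> * q u" for u
    by (simp add: p_def q_def algebra_simps sum.distrib sum_distrib_left)
  have nz: "p u + \<epsilon> * q u \<noteq> 0" if u: "u \<in> insert v F" and "p u \<noteq> 0 \<or> q u \<noteq> 0" for u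
  proof
    assume 0: "p u + \<epsilon> * q u = 0"
    with that have "q u \<noteq> 0" by auto
    with 0 have "\<epsilon> = - p u / q u" by (simp add: field_simps)
    with \<epsilon> u show False by blast
  qed
  from insert.prems have "v \<noteq> (\<lambda>i. 0)" by simp
  then obtain i where "v i \<noteq> 0" by (auto simp: fun_eq_iff)
  then have "0 < q v" unfolding q_def by (intro sum_pos2[of _ i]) (auto simp: zero_less_mult_iff)
  then have "\<forall>u\<in>insert v F. p u + \<epsilon> * q u \<noteq> 0" using nz d by (auto simp: p_def)
  then show ?case by (intro exI[of _ "\<lambda>i. d i + \<epsilon> * real_of_int (v i)"]) (simp add: lin)
qed simp

text \<open>Along a direction that separates the exponents of \<open>A\<close>, any two monomials
  tie at most once, so no ties occur at small positive times.\<close>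

lemma dominated_points_dense:
  fixes A :: "'n::finite tpoly"
  assumes A: "is_tpoly A" "A \<noteq> tpoly_zero"
  obtains Y where "\<And>n. \<exists>b. dominates A b (Y n)" "\<And>i. (\<lambda>n::nat. Y n i) \<longlonglongrightarrow> y i"
proof -
  define M where "M = {m. A m \<noteq> 0}"
  have M: "finite M" using is_tpoly_finite[OF A(1)] by (simp add: M_def)
  define \<Delta> where "\<Delta> = (\<lambda>(a, b) i. int (a i) - int (b i)) ` {(a, b). a \<in> M \<and> b \<in> M \<and> a \<noteq> b}"
  have fin2: "finite {(a, b). a \<in> M \<and> b \<in> M \<and> a \<noteq> b}"
    by (rule finite_subset[of _ "M \<times> M"]) (use M in auto)
  have "\<exists>d::'n \<Rightarrow> real. \<forall>v\<in>\<Delta>. (\<Sum>i\<in>UNIV. of_int (v i) * d i) \<noteq> 0"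
    by (rule generic_direction) (use fin2 in \<open>auto simp: \<Delta>_def fun_eq_iff\<close>)
  then obtain d :: "'n \<Rightarrow> real" where d: "\<And>v. v \<in> \<Delta> \<Longrightarrow> (\<Sum>i\<in>UNIV. of_int (v i) * d i) \<noteq> 0" by blast
  define s where "s m = (\<Sum>i\<in>UNIV. real (m i) * d i)" for m :: "'n \<Rightarrow> nat"
  have s: "s a \<noteq> s b" if "a \<in> M" "b \<in> M" "a \<noteq> b" for a b
    using d[of "\<lambda>i. int (a i) - int (b i)"] that
    by (force simp: \<Delta>_def s_def left_diff_distrib sum_subtractf)
  \<comment> \<open>The times at which two monomials tie; \<open>t0\<close> is no later than the
    first positive one.\<close>
  define bad where "bad = (\<lambda>(a, b). (log_val A b y - log_val A a y) / (s a - s b)) `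
      {(a, b). a \<in> M \<and> b \<in> M \<and> a \<noteq> b}"
  have finbad: "finite bad" unfolding bad_def using fin2 by simp
  define t0 where "t0 = Min (insert 1 {t \<in> bad. 0 < t})"
  have t0: "0 < t0" unfolding t0_def using finbad by (subst Min_gr_iff) auto
  have good: "t \<notin> bad" if "0 < t" "t < t0" for t
  proof
    assume "t \<in> bad"
    then have "t0 \<le> t" unfolding t0_def using finbad that by (intro Min_le) auto
    with that show False by simp
  qed
  have dom: "\<exists>b. dominates A b (\<lambda>i. y i + t * d i)" if t: "0 < t" "t < t0" for t
  proof -
    let ?z = "\<lambda>i. y i + t * d i"
    have inj: "log_val A a ?z \<noteq> log_val A b ?z" if ab: "A a \<noteq> 0" "A b \<noteq> 0" "a \<noteq> b" for a b
    proof
      assume "log_val A a ?z = log_val A b ?z"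
      then have "t * (s a - s b) = log_val A b y - log_val A a y"
        unfolding log_val_line s_def[symmetric] by (simp add: algebra_simps)
      moreover have "s a - s b \<noteq> 0" using s[of a b] ab by (simp add: M_def)
      ultimately have "t = (log_val A b y - log_val A a y) / (s a - s b)" by (simp add: field_simps)
      moreover have "(log_val A b y - log_val A a y) / (s a - s b) \<in> bad"
        unfolding bad_def using ab by (intro image_eqI[of _ _ "(a, b)"]) (auto simp: M_def)
      ultimately show False using good[OF t] by simp
    qed
    obtain m where m: "A m \<noteq> 0" using A(2) by (auto simp: tpoly_zero_def fun_eq_iff)
    have "A m * mono_val (\<lambda>i. exp (?z i)) m \<noteq> 0" using m by (simp add: mono_val_exp)
    moreover have "A a * mono_val (\<lambda>i. exp (?z i)) a \<noteq> A b * mono_val (\<lambda>i. exp (?z i)) b"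
      if "A a \<noteq> 0" "A b \<noteq> 0" "a \<noteq> b" for a b
      using inj[OF that] by (simp add: exp_log_val[OF A(1)] that)
    ultimately have "\<not> is_tzero A (\<lambda>i. exp (?z i))" unfolding is_tzero_def by blast
    then show ?thesis by (simp add: not_is_tzero_exp_iff[OF A(1)])
  qed
  define T where "T n = t0 * (inverse (real (Suc n)) / 2)" for n
  have "T \<longlonglongrightarrow> t0 * (0 / 2)" unfolding T_def by (intro tendsto_intros LIMSEQ_inverse_real_of_nat) simp
  then have lim: "(\<lambda>n. y i + T n * d i) \<longlonglongrightarrow> y i" for i
    using tendsto_add[OF tendsto_const[of "y i"] tendsto_mult[OF \<open>T \<longlonglongrightarrow> t0 * (0 / 2)\<close> tendsto_const[of "d i"]]]
    by simp
  have "inverse (real (Suc n)) / 2 < 1" for n by (simp add: field_simps)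
  then have "0 < T n" "T n < t0" for n using t0 unfolding T_def by (auto intro!: mult_less_cancel_left2[THEN iffD2])
  then show ?thesis using dom lim by (intro that[of "\<lambda>n i. y i + T n * d i"]) auto
qed

section \<open>Divisibility from inclusion of zeros\<close>

lemma dominates_of_tvar_subset:
  fixes P Q :: "'n::finite tpoly"
  assumes "is_tpoly P" "is_tpoly Q" "tvar P \<subseteq> tvar Q" "dominates Q b y"
  shows "\<exists>a. dominates P a y"
proof -
  have "\<not> is_tzero Q (\<lambda>i. exp (y i))" using assms(2,4) not_is_tzero_exp_iff by blast
  then have "(\<lambda>i. exp (y i)) \<notin> tvar P" using subsetD[OF assms(3), of "\<lambda>i. exp (y i)"] by (auto simp: tvar_def)
  then have "\<not> is_tzero P (\<lambda>i. exp (y i))" by (simp add: tvar_def)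
  then show ?thesis by (simp add: not_is_tzero_exp_iff[OF assms(1)])
qed

text \<open>A cell of \<open>Q\<close> is convex and contains no zero of \<open>P\<close>, so the
  dominating monomial of \<open>P\<close> cannot change along a segment in it.\<close>

lemma dominates_on_cell:
  fixes P Q :: "'n::finite tpoly"
  assumes tp: "is_tpoly P" "is_tpoly Q" and sub: "tvar P \<subseteq> tvar Q"
    and Q: "dominates Q b y" "dominates Q b z" and P: "dominates P a y"
  shows "dominates P a z"
  by (rule dominates_along_segment[OF tp(1) P])
    (rule dominates_of_tvar_subset[OF tp sub dominates_segment[OF Q]])

text \<open>Setting the \<open>i\<close>-th coordinate to zero stays inside the cell of \<open>b\<close>, but would kill \<open>a\<close>.\<close>

lemma exponent_zero_on_cell:
  fixes P Q :: "'n::finite tpoly"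
  assumes P: "is_tpoly P" and Q: "is_tpoly Q" and sub: "tvar P \<subseteq> tvar Q"
    and b: "dominates Q b y" and a: "dominates P a y" and "b i = 0"
  shows "a i = 0"
proof (rule ccontr)
  assume ai: "a i \<noteq> 0"
  \<comment> \<open>The monomial \<open>b\<close> keeps its value at \<open>x\<close> because
    \<open>b i = 0\<close>, and the others do not increase, so \<open>x\<close> is still no zero of
    \<open>Q\<close>.\<close>
  define x where "x j = (if j = i then 0 else exp (y j))" for j
  have x: "0 \<le> x j" for j by (simp add: x_def)
  have mono_le: "mono_val x c \<le> mono_val (\<lambda>j. exp (y j)) c" for c
    unfolding mono_val_def by (intro prod_mono conjI power_mono) (auto simp: x_def)
  have mono_eq: "mono_val x b = mono_val (\<lambda>j. exp (y j)) b"
    unfolding mono_val_def by (rule prod.cong) (auto simp: x_def \<open>b i = 0\<close>)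
  have "\<not> is_tzero Q x"
    unfolding not_is_tzero_iff[OF Q x]
  proof (intro exI conjI allI impI)
    show pos: "0 < Q b * mono_val x b"
      unfolding mono_eq using is_tpoly_pos[OF Q dominates_nonzero[OF b]] by (simp add: mono_val_exp)
    fix c assume "c \<noteq> b"
    show "Q c * mono_val x c < Q b * mono_val x b"
    proof (cases "Q c = 0")
      case True
      with pos show ?thesis by simp
    next
      case False
      have "Q c * mono_val x c \<le> Q c * mono_val (\<lambda>j. exp (y j)) c"
        by (rule mult_left_mono[OF mono_le is_tpoly_nonneg[OF Q]])
      also have "\<dots> < Q b * mono_val (\<lambda>j. exp (y j)) b"
        using dominates_less[OF b False \<open>c \<noteq> b\<close>] False dominates_nonzero[OF b]
        by (simp add: exp_log_val[OF Q])
      finally show ?thesis by (simp add: mono_eq)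
    qed
  qed
  then have "\<not> is_tzero P x" using sub x by (auto simp: tvar_def)
  then obtain e where "0 < P e * mono_val x e" unfolding not_is_tzero_iff[OF P x] by blast
  then have Pe: "P e \<noteq> 0" and "mono_val x e \<noteq> 0" by auto
  then have ei: "e i = 0" by (auto simp: mono_val_def x_def)
  with ai have "e \<noteq> a" by auto
  \<comment> \<open>Lowering \<open>y i\<close> by the lead \<open>s\<close> of \<open>a\<close>
    over \<open>e\<close> costs \<open>a\<close> at least \<open>s\<close> and \<open>e\<close>
    nothing. So \<open>a\<close> no longer beats \<open>e\<close>, although the point stays in the
    cell of \<open>b\<close>.\<close>
  define s where "s = log_val P a y - log_val P e y"
  have "0 < s" using dominates_less[OF a Pe \<open>e \<noteq> a\<close>] by (simp add: s_def)
  define w where "w j = y j + s * (if j = i then -1 else 0)" for j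
  have sum: "(\<Sum>j\<in>UNIV. real (m j) * (if j = i then -1 else 0)) = - real (m i)" for m :: "'n \<Rightarrow> nat"
  proof -
    have "(\<Sum>j\<in>UNIV. real (m j) * (if j = i then -1 else 0)) = (\<Sum>j\<in>UNIV. if j = i then - real (m j) else 0)"
      by (rule sum.cong) auto
    then show ?thesis by simp
  qed
  have w: "log_val A m w = log_val A m y - s * real (m i)" for A m
    unfolding w_def log_val_line sum by simp
  have "dominates Q b w"
    unfolding dominates_def
  proof (intro conjI allI impI)
    fix c assume c: "Q c \<noteq> 0" "c \<noteq> b"
    have "0 \<le> s * real (c i)" using \<open>0 < s\<close> by simp
    then show "log_val Q c w < log_val Q b w"
      using dominates_less[OF b c] by (simp add: w \<open>b i = 0\<close>)
  qed (rule dominates_nonzero[OF b])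
  from dominates_less[OF dominates_on_cell[OF P Q sub b this a] Pe \<open>e \<noteq> a\<close>]
  have "s * real (a i) < s" by (simp add: w ei s_def)
  moreover have "s * 1 \<le> s * real (a i)" using \<open>0 < s\<close> ai by (intro mult_left_mono) auto
  ultimately show False by simp
qed

text \<open>Farkas' lemma is applied to the homogenized inequalities describing the region where \<open>b'\<close> beats \<open>b\<close> and
  \<open>b\<close> beats all other monomials of \<open>Q\<close>. Pushing a point \<open>w\<close> of the cell of \<open>b'\<close> towards a solution \<open>(y, s)\<close>
  of them, i.e. to \<open>(w + \<tau> y) / (1 + \<tau> s)\<close>, stays in that cell.\<close>

lemma slope_bound_between_cells:
  fixes P Q :: "'n::finite tpoly"
  assumes Q: "is_tpoly Q" and b: "Q b \<noteq> 0" "b \<noteq> b'" and w: "dominates Q b' w"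
    and le: "\<And>y. dominates Q b' y \<Longrightarrow> log_val P a y \<le> log_val P a' y"
  shows "\<exists>K::nat. \<forall>y. dominates Q b y \<longrightarrow>
    log_val P a y - log_val P a' y \<le> real K * (log_val Q b y - log_val Q b' y)"
proof -
  define J where "J = {m. Q m \<noteq> 0}"
  have J: "finite J" "b \<in> J" "b' \<in> J"
    using is_tpoly_finite[OF Q] b dominates_nonzero[OF w] by (auto simp: J_def)
  \<comment> \<open>The slot \<open>b\<close>, free because \<open>b\<close> is not compared with
    itself, carries the difference of \<open>a\<close> and \<open>a'\<close>. Slot \<open>b'\<close>
    says that \<open>b'\<close> beats \<open>b\<close>, every other slot \<open>j\<close> that
    \<open>b\<close> beats \<open>j\<close>.\<close>
  define v where "v j i = (if j = b then int (a i) - int (a' i) else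
     if j = b' then int (b' i) - int (b i) else int (b i) - int (j i))" for j i
  define c where "c j = (if j = b then ln (P a) - ln (P a') else
     if j = b' then ln (Q b') - ln (Q b) else ln (Q b) - ln (Q j))" for j
  define hom where "hom A m y s = (\<Sum>i\<in>UNIV. real (m i) * y i) + s * ln (A m)"
    for A :: "'n tpoly" and m y s
  define D where "D j y s = (\<Sum>i\<in>UNIV. real_of_int (v j i) * y i) + s * c j" for j y s
  have Db: "D b y s = hom P a y s - hom P a' y s" for y s
    by (simp add: D_def v_def c_def hom_def algebra_simps sum_subtractf)
  have Db': "D b' y s = hom Q b' y s - hom Q b y s" for y s
    using b(2) by (simp add: D_def v_def c_def hom_def algebra_simps sum_subtractf)
  have Dj: "D j y s = hom Q b y s - hom Q j y s" if "j \<noteq> b" "j \<noteq> b'" for j y s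
    using that by (simp add: D_def v_def c_def hom_def algebra_simps sum_subtractf)
  have hom1: "hom A m y 1 = log_val A m y" for A m y by (simp add: hom_def log_val_def)
  have "\<exists>N. N b > (0::nat) \<and> (\<forall>i. (\<Sum>j\<in>J. int (N j) * v j i) = 0) \<and> (\<Sum>j\<in>J. real (N j) * c j) \<le> 0"
  proof (rule farkas_homogeneous[OF J(1,2), of v c])
    fix s :: real and y :: "'n \<Rightarrow> real"
    assume s: "0 \<le> s" and "\<And>j. j \<in> J - {b} \<Longrightarrow> 0 \<le> (\<Sum>i\<in>UNIV. real_of_int (v j i) * y i) + s * c j"
    then have D: "0 \<le> D j y s" if "j \<in> J" "j \<noteq> b" for j using that by (simp add: D_def)
    have hom_le: "hom Q j y s \<le> hom Q b' y s" if "Q j \<noteq> 0" for j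
    proof -
      have "hom Q b y s \<le> hom Q b' y s" using D[OF J(3)] b(2) by (simp add: Db')
      moreover have "hom Q j y s \<le> hom Q b y s" if "j \<noteq> b" "j \<noteq> b'"
        using D[of j] \<open>Q j \<noteq> 0\<close> that by (simp add: Dj J_def)
      ultimately show ?thesis by (cases "j = b"; cases "j = b'") auto
    qed
    \<comment> \<open>Clearing the denominator \<open>1 + \<tau> * s\<close> leaves a bound affine
      in \<tau>; a large \<tau> then excludes \<open>D b y s > 0\<close>.\<close>
    have push: "log_val P a w - log_val P a' w + \<tau> * D b y s \<le> 0" if \<tau>: "0 \<le> \<tau>" for \<tau>
    proof -
      define z where "z i = (w i + \<tau> * y i) / (1 + \<tau> * s)" for i
      have pos: "0 < 1 + \<tau> * s" using \<tau> s by (simp add: add_pos_nonneg)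
      have lz: "log_val A m z = (log_val A m w + \<tau> * hom A m y s) / (1 + \<tau> * s)" for A m
      proof -
        have "(\<Sum>i\<in>UNIV. real (m i) * z i) =
            ((\<Sum>i\<in>UNIV. real (m i) * w i) + \<tau> * (\<Sum>i\<in>UNIV. real (m i) * y i)) / (1 + \<tau> * s)"
          by (simp add: z_def sum_divide_distrib sum_distrib_left add_divide_distrib distrib_left
              sum.distrib mult.left_commute)
        then show ?thesis using pos by (simp add: log_val_def hom_def field_simps)
      qed
      have "dominates Q b' z"
        unfolding dominates_def
      proof (intro conjI allI impI)
        fix j assume j: "Q j \<noteq> 0" "j \<noteq> b'"
        have "\<tau> * hom Q j y s \<le> \<tau> * hom Q b' y s" using hom_le[OF j(1)] \<tau> by (rule mult_left_mono)
        then show "log_val Q j z < log_val Q b' z"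
          unfolding lz using dominates_less[OF w j] pos by (intro divide_strict_right_mono) auto
      qed (rule dominates_nonzero[OF w])
      from le[OF this] show ?thesis
        unfolding lz Db using pos by (simp add: divide_le_cancel algebra_simps)
    qed
    have "D b y s \<le> 0"
    proof (rule ccontr)
      assume "\<not> ?thesis"
      then have "0 < D b y s" by simp
      then show False
        using push[of "(log_val P a' w - log_val P a w + 1) / D b y s"] le[OF w] by simp
    qed
    then show "(\<Sum>i\<in>UNIV. real_of_int (v b i) * y i) + s * c b \<le> 0" by (simp add: D_def)
  qed blast
  then obtain N where N: "N b > (0::nat)" "\<And>i. (\<Sum>j\<in>J. int (N j) * v j i) = 0"
    "(\<Sum>j\<in>J. real (N j) * c j) \<le> 0" by blast
  have "log_val P a y - log_val P a' y \<le> real (N b') * (log_val Q b y - log_val Q b' y)"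
    if y: "dominates Q b y" for y
  proof -
    let ?f = "log_val P a y - log_val P a' y" and ?g = "log_val Q b y - log_val Q b' y"
    have g: "0 < ?g" using dominates_less[OF y dominates_nonzero[OF w]] b(2) by simp
    have "(\<Sum>j\<in>J. real (N j) * D j y 1) =
        (\<Sum>i\<in>UNIV. (\<Sum>j\<in>J. real (N j) * real_of_int (v j i)) * y i) + (\<Sum>j\<in>J. real (N j) * c j)"
    proof -
      have "(\<Sum>j\<in>J. real (N j) * D j y 1) =
          (\<Sum>j\<in>J. \<Sum>i\<in>UNIV. real (N j) * real_of_int (v j i) * y i) + (\<Sum>j\<in>J. real (N j) * c j)"
        by (simp add: D_def distrib_left sum.distrib sum_distrib_left mult.assoc)
      then show ?thesis by (subst (asm) sum.swap) (simp add: sum_distrib_right)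
    qed
    moreover have "(\<Sum>j\<in>J. real (N j) * real_of_int (v j i)) = 0" for i
      using arg_cong[OF N(2)[of i], of real_of_int] by simp
    ultimately have "(\<Sum>j\<in>J. real (N j) * D j y 1) \<le> 0" using N(3) by simp
    moreover have "(\<Sum>j\<in>J. (if j = b then real (N b) * ?f else 0) + (if j = b' then - real (N b') * ?g else 0))
        \<le> (\<Sum>j\<in>J. real (N j) * D j y 1)"
    proof (rule sum_mono)
      fix j assume j: "j \<in> J"
      show "(if j = b then real (N b) * ?f else 0) + (if j = b' then - real (N b') * ?g else 0)
          \<le> real (N j) * D j y 1"
        using b(2) dominates_le[OF y, of j] j
        by (auto simp: Db Db' Dj hom1 J_def algebra_simps intro: mult_left_mono)
    qed
    ultimately have *: "real (N b) * ?f \<le> real (N b') * ?g"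
      using J by (simp add: sum.distrib)
    show ?thesis
    proof (cases "?f \<le> 0")
      case True
      then show ?thesis using g by (meson mult_nonneg_nonneg of_nat_0_le_iff order.trans less_imp_le)
    next
      case False
      then have "1 * ?f \<le> real (N b) * ?f" using N(1) by (intro mult_right_mono) auto
      with * show ?thesis by simp
    qed
  qed
  then show ?thesis by blast
qed

lemma dvd_pow_of_tvar_subset:
  fixes P Q :: "'n::finite tpoly"
  assumes P: "is_tpoly P" "P \<noteq> tpoly_zero" and Q: "is_tpoly Q" "Q \<noteq> tpoly_zero"
    and sub: "tvar P \<subseteq> tvar Q"
  shows "\<exists>k\<ge>1. tpoly_dvd P (tpoly_pow Q k)"
proof -
  \<comment> \<open>The monomials of \<open>Q\<close> with a nonempty cell; only these contribute to
    \<open>R\<close>.\<close>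
  define E where "E = {b. \<exists>y. dominates Q b y}"
  have E: "finite E"
    by (rule finite_subset[OF _ is_tpoly_finite[OF Q(1)]]) (auto simp: E_def dominates_def)
  have "\<exists>a. \<forall>y. dominates Q b y \<longrightarrow> dominates P a y" for b
  proof (cases "b \<in> E")
    case True
    then obtain y where y: "dominates Q b y" by (auto simp: E_def)
    from dominates_of_tvar_subset[OF P(1) Q(1) sub y] obtain a where "dominates P a y" ..
    then show ?thesis using dominates_on_cell[OF P(1) Q(1) sub y] by blast
  qed (auto simp: E_def)
  then obtain \<alpha> where \<alpha>: "\<And>b y. dominates Q b y \<Longrightarrow> dominates P (\<alpha> b) y" by metis
  have QE: "Q b \<noteq> 0" and PE: "P (\<alpha> b) \<noteq> 0" if "b \<in> E" for b
    using that \<alpha> by (auto simp: E_def dest: dominates_nonzero)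
  have "\<exists>K::nat. \<forall>y. dominates Q b y \<longrightarrow>
      log_val P (\<alpha> b) y - log_val P (\<alpha> b') y \<le> real K * (log_val Q b y - log_val Q b' y)"
    if bb: "b \<in> E" "b' \<in> E" for b b'
  proof (cases "b = b'")
    case False
    from bb(2) obtain w where w: "dominates Q b' w" by (auto simp: E_def)
    show ?thesis
      by (rule slope_bound_between_cells[OF Q(1) QE[OF bb(1)] False w])
        (rule dominates_le[OF \<alpha> PE[OF bb(1)]])
  qed simp
  then obtain K :: "('n \<Rightarrow> nat) \<Rightarrow> ('n \<Rightarrow> nat) \<Rightarrow> nat" where K: "\<And>b b' y. b \<in> E \<Longrightarrow> b' \<in> E \<Longrightarrow>
      dominates Q b y \<Longrightarrow>
      log_val P (\<alpha> b) y - log_val P (\<alpha> b') y \<le> real (K b b') * (log_val Q b y - log_val Q b' y)"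
    by metis
  \<comment> \<open>\<open>k\<close> bounds the slope constants, so that on each cell its own term
    of \<open>R\<close> is maximal, and the exponents \<open>\<alpha> b i\<close>, so that the
    exponents of \<open>R\<close> are nonnegative. The entry 1 gives
    \<open>k \<ge> 1\<close>.\<close>
  define k where "k = Max (insert 1 ((\<lambda>(b, b'). K b b') ` (E \<times> E) \<union> (\<lambda>(b, i). \<alpha> b i) ` (E \<times> UNIV)))"
  have finite_k: "finite (insert 1 ((\<lambda>(b, b'). K b b') ` (E \<times> E) \<union> (\<lambda>(b, i). \<alpha> b i) ` (E \<times> UNIV)))"
    using E by simp
  have k1: "1 \<le> k" unfolding k_def by (rule Max_ge[OF finite_k]) simp
  have kK: "K b b' \<le> k" if "b \<in> E" "b' \<in> E" for b b'
    unfolding k_def by (rule Max_ge[OF finite_k]) (use that in force)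
  have k\<alpha>: "\<alpha> b i \<le> k" if "b \<in> E" for b i
    unfolding k_def by (rule Max_ge[OF finite_k]) (use that in force)
  have exponent: "\<alpha> b i \<le> k * b i" if bE: "b \<in> E" for b i
  proof (cases "b i = 0")
    case True
    from bE obtain y where y: "dominates Q b y" by (auto simp: E_def)
    from exponent_zero_on_cell[OF P(1) Q(1) sub y \<alpha>[OF y] True] show ?thesis by simp
  next
    case False
    have "\<alpha> b i \<le> k * 1" using k\<alpha>[OF bE] by simp
    also have "\<dots> \<le> k * b i" using False by (intro mult_left_mono) auto
    finally show ?thesis .
  qed
  \<comment> \<open>By \<open>exponent\<close> the subtraction does not truncate for
    \<open>b\<close> in \<open>E\<close>. Different \<open>b\<close> may share the exponent
    \<open>r b\<close>, hence the maximum in \<open>R\<close>.\<close>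
  define r where "r b i = k * b i - \<alpha> b i" for b i
  define R where "R m = Max (insert 0 ((\<lambda>b. Q b ^ k / P (\<alpha> b)) ` {b \<in> E. r b = m}))" for m
  have fin_R: "finite (insert 0 ((\<lambda>b. Q b ^ k / P (\<alpha> b)) ` {b \<in> E. r b = m}))" for m
    using E by simp
  have R_ge: "Q b ^ k / P (\<alpha> b) \<le> R (r b)" if "b \<in> E" for b
    unfolding R_def by (rule Max_ge[OF fin_R]) (use that in auto)
  have R_cases: "\<exists>b\<in>E. m = r b \<and> R m = Q b ^ k / P (\<alpha> b)" if "R m \<noteq> 0" for m
    using Max_in[OF fin_R[of m]] that unfolding R_def[symmetric] by auto
  have "{m. R m \<noteq> 0} \<subseteq> r ` E" using R_cases by blast
  then have "finite {m. R m \<noteq> 0}" using E by (simp add: finite_subset)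
  moreover have "0 \<le> R m" for m unfolding R_def by (rule Max_ge[OF fin_R]) simp
  ultimately have R: "is_tpoly R" by (simp add: is_tpoly_def)
  have R_term: "Q b ^ k / P (\<alpha> b) * mono_val (\<lambda>i. exp (y i)) (r b) =
      exp (real k * log_val Q b y - log_val P (\<alpha> b) y)" if bE: "b \<in> E" for b y
  proof -
    have "(\<Sum>i\<in>UNIV. real (r b i) * y i) =
        real k * (\<Sum>i\<in>UNIV. real (b i) * y i) - (\<Sum>i\<in>UNIV. real (\<alpha> b i) * y i)"
      by (simp add: r_def of_nat_diff exponent[OF bE] left_diff_distrib sum_subtractf sum_distrib_left mult.assoc)
    moreover have "Q b ^ k / P (\<alpha> b) = exp (real k * ln (Q b) - ln (P (\<alpha> b)))"
      using is_tpoly_pos[OF Q(1) QE[OF bE]] is_tpoly_pos[OF P(1) PE[OF bE]]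
      by (simp add: exp_diff exp_of_nat_mult)
    ultimately show ?thesis
      by (simp add: mono_val_exp log_val_def algebra_simps flip: exp_add)
  qed
  \<comment> \<open>On the cell of \<open>b\<close> the term of \<open>R\<close> coming from
    \<open>b\<close> is the largest; multiplied by the dominating monomial \<open>\<alpha> b\<close>
    of \<open>P\<close> it gives the \<open>k\<close>-th power of the value of
    \<open>Q\<close>.\<close>
  have on_cell: "tpoly_eval (tpoly_pow Q k) (\<lambda>i. exp (y i)) = tpoly_eval (tpoly_mult P R) (\<lambda>i. exp (y i))"
    if y: "dominates Q b y" for b y
  proof -
    have bE: "b \<in> E" using y by (auto simp: E_def)
    have "tpoly_eval R (\<lambda>i. exp (y i)) = exp (real k * log_val Q b y - log_val P (\<alpha> b) y)"
    proof (rule order_antisym)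
      show "tpoly_eval R (\<lambda>i. exp (y i)) \<le> exp (real k * log_val Q b y - log_val P (\<alpha> b) y)"
      proof (rule tpoly_eval_leI[OF R])
        fix m assume "R m \<noteq> 0"
        from R_cases[OF this] obtain b' where b': "b' \<in> E" "m = r b'" "R m = Q b' ^ k / P (\<alpha> b')" by blast
        have "log_val P (\<alpha> b) y - log_val P (\<alpha> b') y \<le> real (K b b') * (log_val Q b y - log_val Q b' y)"
          by (rule K[OF bE b'(1) y])
        also have "\<dots> \<le> real k * (log_val Q b y - log_val Q b' y)"
          using kK[OF bE b'(1)] dominates_le[OF y QE[OF b'(1)]] by (intro mult_right_mono) auto
        finally have "real k * log_val Q b' y - log_val P (\<alpha> b') y \<le> real k * log_val Q b y - log_val P (\<alpha> b) y"
          by (simp add: algebra_simps)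
        then show "R m * mono_val (\<lambda>i. exp (y i)) m \<le> exp (real k * log_val Q b y - log_val P (\<alpha> b) y)"
          unfolding b'(3) unfolding b'(2) R_term[OF b'(1)] by simp
      qed simp
      have "exp (real k * log_val Q b y - log_val P (\<alpha> b) y) \<le> R (r b) * mono_val (\<lambda>i. exp (y i)) (r b)"
        unfolding R_term[OF bE, symmetric] by (rule mult_right_mono[OF R_ge[OF bE] mono_val_nonneg]) simp
      also have "\<dots> \<le> tpoly_eval R (\<lambda>i. exp (y i))" by (rule tpoly_eval_ge[OF R]) simp
      finally show "exp (real k * log_val Q b y - log_val P (\<alpha> b) y) \<le> tpoly_eval R (\<lambda>i. exp (y i))" .
    qed
    then show ?thesis
      by (simp add: tpoly_eval_pow[OF Q(1)] tpoly_eval_mult[OF P(1) R] tpoly_eval_dominates[OF Q(1) y]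
          tpoly_eval_dominates[OF P(1) \<alpha>[OF y]] flip: exp_of_nat_mult exp_add)
  qed
  \<comment> \<open>The cells of \<open>Q\<close> are dense and both sides are continuous.\<close>
  have "tpoly_eval (tpoly_pow Q k) (\<lambda>i. exp (y i)) = tpoly_eval (tpoly_mult P R) (\<lambda>i. exp (y i))" for y
  proof -
    obtain Y where Y: "\<And>n. \<exists>b. dominates Q b (Y n)" and lim: "\<And>i. (\<lambda>n::nat. Y n i) \<longlonglongrightarrow> y i"
      by (rule dominated_points_dense[OF Q, where y = y]) blast
    have X: "(\<lambda>n. exp (Y n i)) \<longlonglongrightarrow> exp (y i)" for i by (intro tendsto_exp lim)
    have "(\<lambda>n. tpoly_eval (tpoly_pow Q k) (\<lambda>i. exp (Y n i))) \<longlonglongrightarrow> tpoly_eval (tpoly_pow Q k) (\<lambda>i. exp (y i))"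
      by (rule tendsto_tpoly_eval[OF is_tpoly_pow[OF Q(1)] X])
    moreover have "(\<lambda>n. tpoly_eval (tpoly_mult P R) (\<lambda>i. exp (Y n i))) \<longlonglongrightarrow> tpoly_eval (tpoly_mult P R) (\<lambda>i. exp (y i))"
      by (rule tendsto_tpoly_eval[OF is_tpoly_mult[OF P(1) R] X])
    moreover have "tpoly_eval (tpoly_pow Q k) (\<lambda>i. exp (Y n i)) = tpoly_eval (tpoly_mult P R) (\<lambda>i. exp (Y n i))" for n
      using Y[of n] on_cell by blast
    ultimately show ?thesis by (simp add: LIMSEQ_unique)
  qed
  then have "tpoly_equiv (tpoly_pow Q k) (tpoly_mult P R)"
    by (rule tpoly_equiv_if_eval_eq[OF is_tpoly_pow[OF Q(1)] is_tpoly_mult[OF P(1) R]])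
  then show ?thesis using k1 R by (auto simp: tpoly_dvd_def)
qed

theorem theorem3p10:
  fixes P Q :: "('n::finite \<Rightarrow> nat) \<Rightarrow> real"
  assumes "is_tpoly P" and "is_tpoly Q"
  shows "tvar P \<subseteq> tvar Q \<longleftrightarrow> (\<exists>k\<ge>1. tpoly_dvd P (tpoly_pow Q k))"
proof
  assume "\<exists>k\<ge>1. tpoly_dvd P (tpoly_pow Q k)"
  then show "tvar P \<subseteq> tvar Q" using tvar_subset_of_dvd_pow[OF assms] by blast
next
  assume sub: "tvar P \<subseteq> tvar Q"
  show "\<exists>k\<ge>1. tpoly_dvd P (tpoly_pow Q k)"
  proof (cases "Q = tpoly_zero")
    case True
    \<comment> \<open>The zero polynomial is divisible by every \<open>P\<close>, with quotient
      zero.\<close>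
    have "tpoly_pow Q 1 = tpoly_mult P tpoly_zero"
      by (simp add: True tpoly_mult_zero tpoly_mult_one is_tpoly_zero tpoly_mult_commute[of tpoly_zero])
    then have "tpoly_dvd P (tpoly_pow Q 1)"
      unfolding tpoly_dvd_def using is_tpoly_zero tpoly_equiv_refl by metis
    then show ?thesis by blast
  next
    case False
    \<comment> \<open>A nonzero \<open>Q\<close> has a point with a dominating monomial. The
      inclusion yields a dominating monomial of \<open>P\<close> there, so \<open>P\<close> is
      nonzero.\<close>
    obtain y b where "dominates Q b y" using dominated_points_dense[OF assms(2) False] by metis
    then obtain a where "dominates P a y" using dominates_of_tvar_subset[OF assms sub] by blast
    then have "P \<noteq> tpoly_zero" by (auto simp: dominates_def tpoly_zero_def)
    with False show ?thesis using dvd_pow_of_tvar_subset assms sub by blast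
  qed
qed

end
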